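(* Let $n$ be a positive integer, let $y_I \in \mathbb{Z}_{\geq 0}$ for each nonempty subset $I \subset [n]=\{1,\dots,n\}$, and let $P = P_n^Y(\{y_I\}) = \sum_{\emptyset\neq I \subset [n]} y_I \Delta_I \subset \mathbb{R}^n$ (Minkowski sum). Let $K$ be a field. Then: (a) $P$ has the integer decomposition property; (b) the toric ideal of $P$ (over $K$) has a squarefree initial ideal, i.e. there is a monomial order with respect to which its initial ideal is generated by squarefree monomials; (c) the toric ideal of $P$ is generated by quadratic binomials.
   Context: For a nonempty subset $I \subset [n]$, $\Delta_I$ denotes the convex hull of $\{\mathbf{e}_i : i \in I\} \subset \mathbb{R}^n$, where $\mathbf{e}_i$ is the $i$-th unit vector of $\mathbb{R}^n$. The sum is the Minkowski sum of polytopes, $y_I\Delta_I$ is the dilation of $\Delta_I$ by $y_I$ (with $0\cdot\Delta_I=\{0\}$). A lattice polytope $P \subset \mathbb{R}^d$ is a convex polytope all of whose vertices lie in $\mathbb{Z}^d$. It has the integer decomposition property (is IDP) if for every positive integer $k$ and every $\alpha \in kP \cap \mathbb{Z}^d$ there exist $\alpha_1,\dots,\alpha_k \in P\cap\mathbb{Z}^d$ with $\alpha = \alpha_1+\cdots+\alpha_k$. The toric ideal of a lattice polytope $P\subset\mathbb{R}^d$ over a field $K$: let $\mathcal{A}_P = \{(\alpha,1)\in\mathbb{Z}^{d+1} : \alpha \in P\cap\mathbb{Z}^d\} = \{\mathbf{a}_1,\dots,\mathbf{a}_m\}$ (distinct points). The toric ideal is the kernel of the $K$-algebra homomorphism $\pi: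 K[x_1,\dots,x_m] \to K[t_1^{\pm1},\dots,t_{d+1}^{\pm1}]$, $\pi(x_i) = \mathbf{t}^{\mathbf{a}_i}$, where $\mathbf{t}^{\mathbf{a}} = t_1^{a_1}\cdots t_{d+1}^{a_{d+1}}$. A quadratic binomial is a binomial homogeneous of degree $2$; the zero ideal is regarded as generated by the empty set of quadratic binomials (and its initial ideal as squarefree). *)

theory Defs
  imports "HOL-Analysis.Analysis" "HOL-Library.Poly_Mapping" "HOL-Library.Set_Algebras"
begin

text \<open>The index set \<open>[n]\<close> is a finite type \<open>'n\<close>; the lattice \<open>\<int>\<^sup>n\<close> is the type
  \<open>int ^ 'n\<close>, embedded in \<open>\<real>\<^sup>n\<close> by the following map.\<close>

definition real_vec :: "int ^ 'n \<Rightarrow> real ^ 'n" where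
  "real_vec \<alpha> = (\<chi> i. real_of_int (\<alpha> $ i))"

definition lattice_points :: "(real ^ 'n) set \<Rightarrow> (int ^ 'n) set" where
  "lattice_points P = {\<alpha>. real_vec \<alpha> \<in> P}"

definition lattice_polytope :: "(real ^ 'n) set \<Rightarrow> bool" where
  "lattice_polytope P \<longleftrightarrow> polytope P \<and> (\<forall>v. v extreme_point_of P \<longrightarrow> v \<in> range real_vec)"

definition dilate :: "real \<Rightarrow> 'a::real_vector set \<Rightarrow> 'a set" where
  "dilate c P = (\<lambda>x. c *\<^sub>R x) ` P"

definition coord_simplex :: "'n set \<Rightarrow> (real ^ 'n) set" where
  "coord_simplex I = convex hull ((\<lambda>i. axis i 1) ` I)"

text \<open>The sum below is the Minkowski sum (\<open>+\<close> on sets from \<open>Set_Algebras\<close>, with neutral element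
  \<open>{0}\<close>). The value of \<open>y\<close> at the empty set is irrelevant.\<close>

definition Y_polytope :: "('n::finite set \<Rightarrow> nat) \<Rightarrow> (real ^ 'n) set" where
  "Y_polytope y = (\<Sum>I\<in>{I. I \<noteq> {}}. dilate (real (y I)) (coord_simplex I))"

definition IDP :: "(real ^ 'n) set \<Rightarrow> bool" where
  "IDP P \<longleftrightarrow> lattice_polytope P \<and>
     (\<forall>k>0. \<forall>\<alpha>\<in>lattice_points (dilate (real k) P).
        \<exists>a :: nat \<Rightarrow> int ^ 'n. (\<forall>j\<in>{1..k}. a j \<in> lattice_points P) \<and> \<alpha> = (\<Sum>j=1..k. a j))"


text \<open>A monomial is its exponent function \<open>'v \<Rightarrow>\<^sub>0 nat\<close>, so multiplication of monomials is \<open>+\<close>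
  and the monomial \<open>1\<close> is \<open>0\<close>. The ring \<open>K[x\<^sub>v : v \<in> V]\<close> is the subset \<open>polys V\<close> of the monoid
  algebra type \<open>('v \<Rightarrow>\<^sub>0 nat) \<Rightarrow>\<^sub>0 'k\<close>.\<close>

definition monomials :: "'v set \<Rightarrow> ('v \<Rightarrow>\<^sub>0 nat) set" where
  "monomials V = {u. Poly_Mapping.keys u \<subseteq> V}"

definition polys :: "'v set \<Rightarrow> (('v \<Rightarrow>\<^sub>0 nat) \<Rightarrow>\<^sub>0 'k::field) set" where
  "polys V = {f. Poly_Mapping.keys f \<subseteq> monomials V}"

abbreviation monom_poly :: "('v \<Rightarrow>\<^sub>0 nat) \<Rightarrow> (('v \<Rightarrow>\<^sub>0 nat) \<Rightarrow>\<^sub>0 'k::field)" where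
  "monom_poly u \<equiv> Poly_Mapping.single u 1"

definition monomial_degree :: "('v \<Rightarrow>\<^sub>0 nat) \<Rightarrow> nat" where
  "monomial_degree u = (\<Sum>v\<in>Poly_Mapping.keys u. Poly_Mapping.lookup u v)"

definition squarefree_monomial :: "('v \<Rightarrow>\<^sub>0 nat) \<Rightarrow> bool" where
  "squarefree_monomial u \<longleftrightarrow> (\<forall>v. Poly_Mapping.lookup u v \<le> 1)"

text \<open>The ideal of \<open>polys V\<close> (not of the whole type) generated by a set \<open>G \<subseteq> polys V\<close>.\<close>

definition ideal_generated ::
  "'v set \<Rightarrow> (('v \<Rightarrow>\<^sub>0 nat) \<Rightarrow>\<^sub>0 'k::field) set \<Rightarrow> (('v \<Rightarrow>\<^sub>0 nat) \<Rightarrow>\<^sub>0 'k) set" where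
  "ideal_generated V G =
     {\<Sum>g\<in>F. h g * g | F h. finite F \<and> F \<subseteq> G \<and> (\<forall>g\<in>F. h g \<in> polys V)}"

text \<open>\<open>(u, v) \<in> r\<close> reads \<open>u \<le> v\<close>.\<close>

definition monomial_order :: "'v set \<Rightarrow> (('v \<Rightarrow>\<^sub>0 nat) \<times> ('v \<Rightarrow>\<^sub>0 nat)) set \<Rightarrow> bool" where
  "monomial_order V r \<longleftrightarrow> linear_order_on (monomials V) r \<and>
     (\<forall>u\<in>monomials V. (0, u) \<in> r) \<and>
     (\<forall>u\<in>monomials V. \<forall>v\<in>monomials V. \<forall>w\<in>monomials V.
        (u, v) \<in> r \<longrightarrow> (u + w, v + w) \<in> r)"

definition initial_monomial ::
  "(('v \<Rightarrow>\<^sub>0 nat) \<times> ('v \<Rightarrow>\<^sub>0 nat)) set \<Rightarrow> (('v \<Rightarrow>\<^sub>0 nat) \<Rightarrow>\<^sub>0 'k::field) \<Rightarrow> ('v \<Rightarrow>\<^sub>0 nat)" where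
  "initial_monomial r f = (THE u. u \<in> Poly_Mapping.keys f \<and> (\<forall>v\<in>Poly_Mapping.keys f. (v, u) \<in> r))"

definition initial_ideal ::
  "'v set \<Rightarrow> (('v \<Rightarrow>\<^sub>0 nat) \<times> ('v \<Rightarrow>\<^sub>0 nat)) set \<Rightarrow> (('v \<Rightarrow>\<^sub>0 nat) \<Rightarrow>\<^sub>0 'k::field) set
    \<Rightarrow> (('v \<Rightarrow>\<^sub>0 nat) \<Rightarrow>\<^sub>0 'k) set" where
  "initial_ideal V r J =
     ideal_generated V {monom_poly (initial_monomial r f) | f. f \<in> J \<and> f \<noteq> 0}"

definition has_squarefree_initial_ideal ::
  "'v set \<Rightarrow> (('v \<Rightarrow>\<^sub>0 nat) \<Rightarrow>\<^sub>0 'k::field) set \<Rightarrow> bool" where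
  "has_squarefree_initial_ideal V J \<longleftrightarrow>
     (\<exists>r. monomial_order V r \<and>
        (\<exists>S\<subseteq>monomials V. (\<forall>u\<in>S. squarefree_monomial u) \<and>
           initial_ideal V r J = ideal_generated V (monom_poly ` S)))"

definition quadratic_binomial :: "'v set \<Rightarrow> (('v \<Rightarrow>\<^sub>0 nat) \<Rightarrow>\<^sub>0 'k::field) \<Rightarrow> bool" where
  "quadratic_binomial V g \<longleftrightarrow>
     (\<exists>u\<in>monomials V. \<exists>v\<in>monomials V. u \<noteq> v \<and> monomial_degree u = 2 \<and> monomial_degree v = 2 \<and>
        g = monom_poly u - monom_poly v)"

definition generated_by_quadratic_binomials ::
  "'v set \<Rightarrow> (('v \<Rightarrow>\<^sub>0 nat) \<Rightarrow>\<^sub>0 'k::field) set \<Rightarrow> bool" where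
  "generated_by_quadratic_binomials V J \<longleftrightarrow>
     (\<exists>G. (\<forall>g\<in>G. quadratic_binomial V g) \<and> J = ideal_generated V G)"


text \<open>Exponent vectors in \<open>\<int>\<^bsup>d+1\<^esup>\<close> are pairs in \<open>(int ^ 'n) \<times> int\<close>, and the Laurent polynomial
  ring is the group algebra \<open>((int ^ 'n) \<times> int) \<Rightarrow>\<^sub>0 'k\<close>. The variables of the source ring are
  indexed by the lattice points \<open>\<alpha>\<close> themselves; \<open>toric_hom\<close> is the substitution
  \<open>x\<^sub>\<alpha> \<mapsto> t\<^bsup>(\<alpha>,1)\<^esup>\<close>.\<close>

definition toric_hom ::
  "((int ^ 'n \<Rightarrow>\<^sub>0 nat) \<Rightarrow>\<^sub>0 'k::field) \<Rightarrow> (((int ^ 'n) \<times> int) \<Rightarrow>\<^sub>0 'k)" where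
  "toric_hom f = (\<Sum>u\<in>Poly_Mapping.keys f. Poly_Mapping.single 0 (Poly_Mapping.lookup f u) *
                     (\<Prod>\<alpha>\<in>Poly_Mapping.keys u. Poly_Mapping.single (\<alpha>, 1) 1 ^ Poly_Mapping.lookup u \<alpha>))"

definition toric_ideal :: "(real ^ 'n) set \<Rightarrow> ((int ^ 'n \<Rightarrow>\<^sub>0 nat) \<Rightarrow>\<^sub>0 'k::field) set" where
  "toric_ideal P = {f \<in> polys (lattice_points P). toric_hom f = 0}"

end

theory Submission
  imports Defs "HOL-Library.Multiset" "HOL-Library.Fun_Lexorder"
begin

text \<open>A point of \<open>kP \<inter> \<int>\<^sup>n\<close> is the vector of column sums of a nonnegative integer matrix with rows
  indexed by the subsets \<open>I\<close>, supported on \<open>i \<in> I\<close>, with row sums \<open>k y\<^sub>I\<close> (Rado's theorem). Such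
  a matrix is a sum of \<open>k\<close> matrices with row sums \<open>y\<^sub>I\<close>, which gives the integer decomposition
  property.

  Two matrices with the same row and column sums differ by exchange cycles that meet every row at most
  once. Hence a cycle fits inside one matrix of a suitable decomposition, where it leaves the lattice
  point unchanged, and the fibres of the toric map are connected by moves between decompositions of the
  same matrix. Sorting the prefix sums of a pair of matrices generates these moves, which gives the
  quadrics.

  For the initial ideal, represent each lattice point by its lexicographically least matrix, and compare
  monomials by the sum of their matrices and then by a quadratic energy that drops under sorting. A
  monomial is standard iff its sum is lexicographically least and its matrices are pairwise sorted; the
  first condition depends only on the support because the cycles have entries \<open>0\<close> and \<open>\<plusminus>1\<close>, the second
  one is a condition on pairs. So a monomial with the same variables as a standard one is standard.\<close>

section \<open>Transport matrices\<close>

text \<open>A fibre of the toric map has two kinds of freedom: a lattice point has many matrices,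
  and a sum of matrices has many decompositions. The second is handled by sorting, which works
  because every matrix has row \<open>I\<close> of sum \<open>y I\<close>: halving the prefix sums
  of a pair, taken row by row, gives back matrices with the same row sums, and a sorted
  decomposition is unique.

  The first is handled by choosing least matrices. The obstacle is that sorting two chosen matrices
  can produce matrices that are not chosen. Minimality of the choice resolves it: rewriting a
  decomposition through the chosen matrices either changes nothing or strictly lowers the sum, and
  the sum is compared before the energy.

  Passing minimality to a smaller support needs a cycle that lowers the matrix, while the cycle
  found first may raise it. Applying a raising cycle moves closer to the target and leaves the
  matrix above it, so a lowering cycle must appear eventually.\<close>

definition row_sum :: "('r \<Rightarrow> 'c::finite \<Rightarrow> nat) \<Rightarrow> 'r \<Rightarrow> nat" where
  "row_sum m I = (\<Sum>i\<in>UNIV. m I i)"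

definition col_sum :: "('r::finite \<Rightarrow> 'c \<Rightarrow> nat) \<Rightarrow> 'c \<Rightarrow> nat" where
  "col_sum m i = (\<Sum>I\<in>UNIV. m I i)"

definition transports :: "('r \<Rightarrow> 'c set) \<Rightarrow> ('r \<Rightarrow> nat) \<Rightarrow> ('r \<Rightarrow> 'c::finite \<Rightarrow> nat) set" where
  "transports E y = {m. (\<forall>I i. m I i \<noteq> 0 \<longrightarrow> i \<in> E I) \<and> (\<forall>I. row_sum m I = y I)}"

definition total :: "('r \<Rightarrow> 'c \<Rightarrow> nat) multiset \<Rightarrow> 'r \<Rightarrow> 'c \<Rightarrow> nat" where
  "total ms I i = (\<Sum>m\<in>#ms. m I i)"

lemma total_simps [simp]:
  "total {#} = (\<lambda>I i. 0)"
  "total (add_mset m ms) = (\<lambda>I i. m I i + total ms I i)"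
  "total (ms + ms') = (\<lambda>I i. total ms I i + total ms' I i)"
  by (auto simp: total_def fun_eq_iff)

lemma row_sum_simps:
  "row_sum (\<lambda>I i. f I i + g I i) = (\<lambda>I. row_sum f I + row_sum g I)"
  "(\<And>I i. g I i \<le> f I i) \<Longrightarrow> row_sum (\<lambda>I i. f I i - g I i) = (\<lambda>I. row_sum f I - row_sum g I)"
  "row_sum (\<lambda>I i. 0) = (\<lambda>I. 0)"
  by (auto simp: row_sum_def sum.distrib sum_subtractf_nat fun_eq_iff)

lemma col_sum_simps:
  "col_sum (\<lambda>I i. f I i + g I i) = (\<lambda>i. col_sum f i + col_sum g i)"
  "(\<And>I i. g I i \<le> f I i) \<Longrightarrow> col_sum (\<lambda>I i. f I i - g I i) = (\<lambda>i. col_sum f i - col_sum g i)"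
  "col_sum (\<lambda>I i. 0) = (\<lambda>i. 0)"
  by (auto simp: col_sum_def sum.distrib sum_subtractf_nat fun_eq_iff)

lemma row_sum_mono: "(\<And>I i. f I i \<le> g I i) \<Longrightarrow> row_sum f I \<le> row_sum g I"
  by (simp add: row_sum_def sum_mono)

lemma row_sum_ge: "m I i \<le> row_sum m I" for i :: "'c::finite"
  unfolding row_sum_def by (rule member_le_sum) auto

lemma transports_entry_le: "m \<in> transports E y \<Longrightarrow> m I i \<le> y I" for i :: "'c::finite"
  using row_sum_ge[of m I i] by (auto simp: transports_def)

lemma finite_transports: "finite (transports E y)"
  for E :: "'r::finite \<Rightarrow> 'c::finite set"
proof (rule finite_subset)
  let ?B = "{f :: 'c \<Rightarrow> nat. \<forall>i. (i \<in> UNIV \<longrightarrow> f i \<in> {..Max (range y)}) \<and> (i \<notin> UNIV \<longrightarrow> f i = 0)}"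
  show "transports E y \<subseteq> {m. \<forall>I. (I \<in> UNIV \<longrightarrow> m I \<in> ?B) \<and> (I \<notin> UNIV \<longrightarrow> m I = (\<lambda>i. 0))}"
    by (auto intro: order_trans[OF transports_entry_le])
  show "finite {m :: 'r \<Rightarrow> 'c \<Rightarrow> nat. \<forall>I. (I \<in> UNIV \<longrightarrow> m I \<in> ?B) \<and> (I \<notin> UNIV \<longrightarrow> m I = (\<lambda>i. 0))}"
    by (intro finite_set_of_finite_funs finite_atMost) simp_all
qed

text \<open>Rado's condition on \<open>\<alpha>\<close>. The tight sets that do not contain \<open>E I\<close> are closed under union,
  so for an index \<open>i \<in> E I\<close> outside the largest of them, one unit can be sent from \<open>I\<close> to \<open>i\<close>.\<close>

lemma transport_exists:
  fixes E :: "'r::finite \<Rightarrow> 'c::finite set"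
  assumes "\<And>A. (\<Sum>I | E I \<subseteq> A. r I) \<le> sum \<alpha> A" and "sum r UNIV = sum \<alpha> UNIV"
  shows "\<exists>m\<in>transports E r. col_sum m = \<alpha>"
  using assms
proof (induction "sum r UNIV" arbitrary: r \<alpha>)
  case 0
  then have "\<forall>I. r I = 0" "\<forall>i. \<alpha> i = 0"
    by (simp_all add: sum_eq_0_iff)
  then have "(\<lambda>I i. 0) \<in> transports E r \<and> col_sum (\<lambda>(I::'r) i. 0) = \<alpha>"
    by (auto simp: transports_def row_sum_simps col_sum_simps)
  then show ?case by blast
next
  case (Suc n)
  define b where "b r A = (\<Sum>I | E I \<subseteq> A. r I)" for A and r :: "'r \<Rightarrow> nat"
  have b_alt: "b r A = (\<Sum>I\<in>UNIV. if E I \<subseteq> A then r I else 0)" for A r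
    unfolding b_def by (simp add: sum.If_cases)
  have le: "b r A \<le> sum \<alpha> A" for A
    using Suc.prems(1) by (simp add: b_def)
  obtain I where I: "r I > 0"
    using Suc.hyps(2) by (metis gr0I sum.neutral nat.distinct(1))
  define T where "T = {A. b r A = sum \<alpha> A \<and> \<not> E I \<subseteq> A}"
  have empty: "{} \<in> T"
  proof -
    have "b r {} = 0" using le[of "{}"] by simp
    moreover from this have "E I \<noteq> {}" using I unfolding b_def by (auto simp: sum_eq_0_iff)
    ultimately show ?thesis by (simp add: T_def)
  qed
  \<comment> \<open>Supermodularity of \<open>b\<close>, with surplus \<open>r I\<close> when the
    union contains \<open>E I\<close> although neither set does. As \<open>r I > 0\<close>, two
    tight sets in \<open>T\<close> leave no room for that surplus, so \<open>T\<close> is closed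
    under union.\<close>
  have super: "b r A + b r B + (if E I \<subseteq> A \<union> B \<and> \<not> E I \<subseteq> A \<and> \<not> E I \<subseteq> B then r I else 0)
      \<le> b r (A \<union> B) + b r (A \<inter> B)" for A B
  proof -
    have "b r A + b r B + (if E I \<subseteq> A \<union> B \<and> \<not> E I \<subseteq> A \<and> \<not> E I \<subseteq> B then r I else 0)
      = (\<Sum>J\<in>UNIV. (if E J \<subseteq> A then r J else 0) + (if E J \<subseteq> B then r J else 0)
         + (if J = I then if E I \<subseteq> A \<union> B \<and> \<not> E I \<subseteq> A \<and> \<not> E I \<subseteq> B then r I else 0 else 0))"
      by (simp add: b_alt sum.distrib)
    also have "\<dots> \<le> (\<Sum>J\<in>UNIV. (if E J \<subseteq> A \<union> B then r J else 0) + (if E J \<subseteq> A \<inter> B then r J else 0))"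
      by (rule sum_mono) auto
    also have "\<dots> = b r (A \<union> B) + b r (A \<inter> B)"
      by (simp add: b_alt sum.distrib)
    finally show ?thesis .
  qed
  have modular: "sum \<alpha> A + sum \<alpha> B = sum \<alpha> (A \<union> B) + sum \<alpha> (A \<inter> B)" for A B
    by (simp add: sum.union_inter)
  have T_un: "A \<union> B \<in> T" if "A \<in> T" "B \<in> T" for A B
    using that super[of A B] modular[of A B] le[of "A \<union> B"] le[of "A \<inter> B"] I
    by (auto simp: T_def split: if_splits)
  have "\<Union>\<F> \<in> T" if "finite \<F>" "\<F> \<subseteq> T" for \<F>
    using that by (induction \<F>) (auto simp: empty T_un)
  then have U: "\<Union>T \<in> T"
    by simp
  then obtain i where i: "i \<in> E I" "i \<notin> \<Union>T"
    unfolding T_def by blast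
  have notT: "b r A < sum \<alpha> A" if "i \<in> A" "\<not> E I \<subseteq> A" for A
  proof (rule ccontr)
    assume "\<not> b r A < sum \<alpha> A"
    then have "A \<in> T" using le[of A] that by (auto simp: T_def)
    then show False using i(2) that by blast
  qed
  \<comment> \<open>If \<open>\<alpha> i\<close> were 0, adding \<open>i\<close> to the largest
    member of \<open>T\<close> would not raise the right-hand side. The new set would be tight
    against \<open>notT\<close>, or would contain \<open>E I\<close> and violate Rado's condition by
    \<open>r I\<close>.\<close>
  have "\<alpha> i > 0"
  proof (rule ccontr)
    assume "\<not> \<alpha> i > 0"
    then have *: "sum \<alpha> (insert i (\<Union>T)) = sum \<alpha> (\<Union>T)"
      using i(2) by simp
    have "b r (\<Union>T) = sum \<alpha> (\<Union>T)" "\<not> E I \<subseteq> \<Union>T"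
      using U by (auto simp: T_def)
    moreover have "b r (\<Union>T) + (if E I \<subseteq> insert i (\<Union>T) \<and> \<not> E I \<subseteq> \<Union>T then r I else 0) \<le> b r (insert i (\<Union>T))"
    proof -
      have "b r (\<Union>T) + (if E I \<subseteq> insert i (\<Union>T) \<and> \<not> E I \<subseteq> \<Union>T then r I else 0)
        = (\<Sum>J\<in>UNIV. (if E J \<subseteq> \<Union>T then r J else 0)
         + (if J = I then if E I \<subseteq> insert i (\<Union>T) \<and> \<not> E I \<subseteq> \<Union>T then r I else 0 else 0))"
        by (simp add: b_alt sum.distrib)
      also have "\<dots> \<le> b r (insert i (\<Union>T))"
        unfolding b_alt by (rule sum_mono) auto
      finally show ?thesis .
    qed
    ultimately show False
      using notT[of "insert i (\<Union>T)"] le[of "insert i (\<Union>T)"] I * by (auto split: if_splits)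
  qed
  define r' where "r' = r(I := r I - 1)"
  define \<alpha>' where "\<alpha>' = \<alpha>(i := \<alpha> i - 1)"
  have r: "r J = r' J + (if J = I then 1 else 0)" for J
    using I by (simp add: r'_def)
  have \<alpha>: "\<alpha> j = \<alpha>' j + (if j = i then 1 else 0)" for j
    using \<open>\<alpha> i > 0\<close> by (simp add: \<alpha>'_def)
  have sum_r: "sum r A = sum r' A + (if I \<in> A then 1 else 0)" if "finite A" for A
    using that by (simp add: r sum.distrib del: of_nat_sum)
  have sum_\<alpha>: "sum \<alpha> A = sum \<alpha>' A + (if i \<in> A then 1 else 0)" for A
    by (simp add: \<alpha> sum.distrib)
  have "\<exists>m\<in>transports E r'. col_sum m = \<alpha>'"
  proof (rule Suc.hyps(1))
    show "n = sum r' UNIV" using Suc.hyps(2) sum_r[of UNIV] by simp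
    show "sum r' UNIV = sum \<alpha>' UNIV" using Suc.prems(2) sum_r[of UNIV] sum_\<alpha>[of UNIV] by simp
    \<comment> \<open>Only sets with \<open>i \<in> A\<close> lose a unit on the right. If
      \<open>E I \<subseteq> A\<close>, the left side loses one too; otherwise \<open>notT\<close>
      provides the slack.\<close>
    show "(\<Sum>I | E I \<subseteq> A. r' I) \<le> sum \<alpha>' A" for A
      using le[of A] notT[of A] sum_r[of "{I. E I \<subseteq> A}"] sum_\<alpha>[of A] i(1)
      unfolding b_def by (auto split: if_splits)
  qed
  then obtain m where m: "m \<in> transports E r'" "col_sum m = \<alpha>'" by blast
  define m' where "m' = (\<lambda>J j. m J j + (if J = I \<and> j = i then 1 else 0))"
  have "row_sum (\<lambda>J j. if J = I \<and> j = i then 1 else 0) J = (if J = I then 1 else 0)" for J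
    by (simp add: row_sum_def)
  moreover have "col_sum (\<lambda>J j. if J = I \<and> j = i then 1 else 0) j = (if j = i then 1 else 0)" for j
    by (simp add: col_sum_def)
  ultimately have "m' \<in> transports E r" "col_sum m' = \<alpha>"
    using m r \<alpha> i(1) by (auto simp: m'_def transports_def row_sum_simps col_sum_simps)
  then show ?case by blast
qed

text \<open>Discrete intermediate values: raising one entry at a time changes the sum in unit steps.
  Applied to a single row, this selects a subrow of given sum that contains a prescribed
  part.\<close>

lemma sum_between:
  fixes f g :: "'c::finite \<Rightarrow> nat"
  assumes "\<And>i. f i \<le> g i" "sum f UNIV \<le> k" "k \<le> sum g UNIV"
  shows "\<exists>h. (\<forall>i. f i \<le> h i \<and> h i \<le> g i) \<and> sum h UNIV = k"
  using assms(2,3)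
proof (induction k rule: dec_induct)
  case base
  then show ?case using assms(1) by blast
next
  case (step k)
  then obtain h where h: "\<forall>i. f i \<le> h i \<and> h i \<le> g i" "sum h UNIV = k" by auto
  have "\<exists>i. h i < g i"
  proof (rule ccontr)
    assume "\<nexists>i. h i < g i"
    then have "sum g UNIV \<le> sum h UNIV" by (intro sum_mono) (simp add: not_less)
    then show False using h step by simp
  qed
  then obtain i where i: "h i < g i" by blast
  have "sum (\<lambda>j. h j + (if j = i then 1 else 0)) UNIV = Suc k"
    using h by (simp add: sum.distrib)
  then show ?case using h i by (intro exI[of _ "\<lambda>j. h j + (if j = i then 1 else 0)"]) (auto simp: le_SucI)
qed

text \<open>The rows are independent, so each is cut separately. Plain decomposition takes
  \<open>P = 0\<close>; for an exchange cycle, \<open>P\<close> is the part to be removed, and the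
  lower bound on \<open>a\<close> places all of it inside one summand.\<close>

lemma transports_split_one:
  fixes E :: "'r::finite \<Rightarrow> 'c::finite set"
  assumes "m \<in> transports E (\<lambda>I. Suc k * y I)" "\<And>I i. P I i \<le> m I i" "\<And>I. row_sum P I \<le> y I"
  shows "\<exists>a\<in>transports E y. (\<forall>I i. P I i \<le> a I i \<and> a I i \<le> m I i) \<and>
           (\<lambda>I i. m I i - a I i) \<in> transports E (\<lambda>I. k * y I)"
proof -
  have "\<forall>I. \<exists>h. (\<forall>i. P I i \<le> h i \<and> h i \<le> m I i) \<and> sum h UNIV = y I"
    using assms by (intro allI sum_between) (auto simp: transports_def row_sum_def)
  then obtain a where a: "\<And>I i. P I i \<le> a I i \<and> a I i \<le> m I i" "\<And>I. row_sum a I = y I"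
    unfolding row_sum_def by metis
  then have "a \<in> transports E y"
    using assms(1) unfolding transports_def by (auto simp: row_sum_def) (metis gr0I le_zero_eq)
  moreover have "(\<lambda>I i. m I i - a I i) \<in> transports E (\<lambda>I. k * y I)"
    using assms(1) a by (auto simp: transports_def row_sum_simps)
  ultimately show ?thesis using a by blast
qed

lemma transports_decompose:
  fixes E :: "'r::finite \<Rightarrow> 'c::finite set"
  assumes "m \<in> transports E (\<lambda>I. k * y I)"
  shows "\<exists>ms. size ms = k \<and> set_mset ms \<subseteq> transports E y \<and> total ms = m"
  using assms
proof (induction k arbitrary: m)
  case 0
  then have "m = (\<lambda>I i. 0)" by (auto simp: transports_def row_sum_def fun_eq_iff)
  then show ?case by (intro exI[of _ "{#}"]) simp
next
  case (Suc k)
  obtain a where a: "a \<in> transports E y" "\<And>I i. a I i \<le> m I i"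
      "(\<lambda>I i. m I i - a I i) \<in> transports E (\<lambda>I. k * y I)"
    using transports_split_one[OF Suc.prems, of "\<lambda>I i. 0"] by (auto simp: row_sum_simps)
  obtain ms where "size ms = k" "set_mset ms \<subseteq> transports E y" "total ms = (\<lambda>I i. m I i - a I i)"
    using Suc.IH[OF a(3)] by blast
  then show ?case using a by (intro exI[of _ "add_mset a ms"]) auto
qed

lemma transports_total:
  assumes "set_mset ms \<subseteq> transports E y"
  shows "total ms \<in> transports E (\<lambda>I. size ms * y I)"
  using assms
proof (induction ms)
  case empty
  then show ?case by (simp add: transports_def row_sum_simps)
next
  case (add m ms)
  then show ?case by (auto simp: transports_def row_sum_simps)
qed

section \<open>Exchange cycles\<close>

text \<open>Take a nonempty invariant set of least cardinality. Its image is again invariant, so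
  minimality makes the image the whole set, and finiteness gives injectivity.\<close>

lemma bij_betw_invariant_subset:
  assumes "finite X" "X \<noteq> {}" "h ` X \<subseteq> X"
  shows "\<exists>C\<subseteq>X. C \<noteq> {} \<and> bij_betw h C C"
proof -
  let ?S = "{C. C \<subseteq> X \<and> C \<noteq> {} \<and> h ` C \<subseteq> C}"
  have "X \<in> ?S" using assms by auto
  then obtain C where C: "C \<in> ?S" "\<And>D. D \<in> ?S \<Longrightarrow> card C \<le> card D"
    using ex_has_least_nat[of "\<lambda>C. C \<in> ?S" X card] by blast
  then have fin: "finite C" using assms(1) finite_subset by blast
  have "h ` C \<in> ?S" using C(1) by auto
  then have "card C \<le> card (h ` C)" using C(2) by blast
  then have card: "card (h ` C) = card C" using card_image_le[OF fin, of h] by simp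
  then have "h ` C = C" using C(1) fin by (simp add: card_subset_eq)
  moreover have "inj_on h C" using fin card by (rule eq_card_imp_inj_on)
  ultimately show ?thesis using C(1) by (auto simp: bij_betw_def)
qed

text \<open>Each nonzero row of \<open>M - M'\<close> has a positive entry, and the column of that entry has a
  negative entry in another row. This is a map on the nonzero rows; a set of rows that it permutes
  gives a cycle which meets every row at most once.\<close>

lemma exchange_cycle:
  fixes M M' :: "'r::finite \<Rightarrow> 'c::finite \<Rightarrow> nat"
  assumes "row_sum M = row_sum M'" "col_sum M = col_sum M'" "M \<noteq> M'"
  shows "\<exists>P Q. (\<forall>I i. P I i \<le> M I i - M' I i) \<and> (\<forall>I i. Q I i \<le> M' I i - M I i) \<and>
    (\<exists>I i. P I i > 0) \<and> row_sum P = row_sum Q \<and> col_sum P = col_sum Q \<and> (\<forall>I. row_sum P I \<le> 1)"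
proof -
  define X where "X = {I. \<exists>i. M I i \<noteq> M' I i}"
  have "X \<noteq> {}" using assms(3) by (auto simp: X_def fun_eq_iff)
  have "\<exists>i. M' I i < M I i" if "I \<in> X" for I
  proof (rule ccontr)
    assume *: "\<nexists>i. M' I i < M I i"
    then have le: "\<And>i. M I i \<le> M' I i" by (simp add: not_less)
    obtain i where "M I i \<noteq> M' I i" using \<open>I \<in> X\<close> by (auto simp: X_def)
    then have "M I i < M' I i" using le[of i] by simp
    then have "row_sum M I < row_sum M' I"
      unfolding row_sum_def using le by (intro sum_strict_mono_ex1) auto
    then show False using assms(1) by simp
  qed
  then obtain f where f: "\<And>I. I \<in> X \<Longrightarrow> M' I (f I) < M I (f I)" by metis
  have "\<exists>J. M J (f I) < M' J (f I)" if "I \<in> X" for I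
  proof (rule ccontr)
    assume "\<nexists>J. M J (f I) < M' J (f I)"
    then have "\<And>J. M' J (f I) \<le> M J (f I)" by (simp add: not_less)
    then have "col_sum M' (f I) < col_sum M (f I)"
      unfolding col_sum_def using f[OF that] by (intro sum_strict_mono_ex1) auto
    then show False using assms(2) by simp
  qed
  then obtain h where h: "\<And>I. I \<in> X \<Longrightarrow> M (h I) (f I) < M' (h I) (f I)" by metis
  have "h I \<in> X" if "I \<in> X" for I
    unfolding X_def using h[OF that] by (intro CollectI exI[of _ "f I"]) simp
  then have "h ` X \<subseteq> X" by blast
  then obtain C where C: "C \<subseteq> X" "C \<noteq> {}" "bij_betw h C C"
    using bij_betw_invariant_subset[of X h] \<open>X \<noteq> {}\<close> by auto
  \<comment> \<open>\<open>g\<close> steps back along the cycle. In row \<open>I\<close> the column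
    \<open>f (g I)\<close> has \<open>M\<close> below \<open>M'\<close> because
    \<open>h (g I) = I\<close>, and there \<open>Q\<close> puts its unit. Column \<open>f J\<close>
    thus loses a unit in row \<open>J\<close> and gains one in row \<open>h J\<close>.\<close>
  define g where "g = inv_into C h"
  have g: "bij_betw g C C" unfolding g_def by (rule bij_betw_inv_into[OF C(3)])
  have hg: "h (g J) = J" "g J \<in> X" if "J \<in> C" for J
    using that C g bij_betw_inv_into_right[OF C(3)] by (auto simp: g_def bij_betw_def)
  define P where "P = (\<lambda>I i. if I \<in> C \<and> i = f I then 1 else 0 :: nat)"
  define Q where "Q = (\<lambda>I i. if I \<in> C \<and> i = f (g I) then 1 else 0 :: nat)"
  have rows: "row_sum P I = (if I \<in> C then 1 else 0)" "row_sum Q I = (if I \<in> C then 1 else 0)" for I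
    by (auto simp: row_sum_def P_def Q_def)
  have "col_sum P = col_sum Q"
  proof
    fix i
    have "col_sum P i = (\<Sum>I\<in>C. if i = f I then 1 else 0)"
      unfolding col_sum_def P_def by (rule sum.mono_neutral_cong_right) auto
    also have "\<dots> = (\<Sum>I\<in>C. if i = f (g I) then 1 else 0)"
      by (rule sum.reindex_bij_betw[OF g, symmetric])
    also have "\<dots> = col_sum Q i"
      unfolding col_sum_def Q_def by (rule sum.mono_neutral_cong_left) auto
    finally show "col_sum P i = col_sum Q i" .
  qed
  have "P I i \<le> M I i - M' I i" for I i
    using f[of I] C(1) by (auto simp: P_def)
  moreover have "Q I i \<le> M' I i - M I i" for I i
    using h[of "g I"] hg[of I] by (auto simp: Q_def)
  moreover have "\<exists>I i. P I i > 0" using C(2) by (auto simp: P_def)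
  moreover have "row_sum P = row_sum Q" by (simp add: rows fun_eq_iff)
  moreover have "row_sum P I \<le> 1" for I by (simp add: rows)
  ultimately show ?thesis using \<open>col_sum P = col_sum Q\<close> by blast
qed

section \<open>Prefix sums and the lexicographic order on matrices\<close>

text \<open>The entries are enumerated row by row, so that row sums are differences of prefix sums.\<close>

definition row_start :: "'c::finite itself \<Rightarrow> 'r::finite \<Rightarrow> nat" where
  "row_start _ I = to_nat I * Suc (Max (range (to_nat :: 'c \<Rightarrow> nat)))"

definition row_end :: "'c::finite itself \<Rightarrow> 'r::finite \<Rightarrow> nat" where
  "row_end _ I = Suc (to_nat I) * Suc (Max (range (to_nat :: 'c \<Rightarrow> nat)))"

definition key :: "'r::finite \<Rightarrow> 'c::finite \<Rightarrow> nat" where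
  "key I i = row_start TYPE('c) I + to_nat i"

text \<open>Keys are compared with \<open>t\<close> instead of being listed, since
  \<open>to_nat\<close> is only known to be injective and the keys may leave gaps; prefix sums stay
  constant across a gap.\<close>

definition prefix_sum :: "nat \<Rightarrow> ('r::finite \<Rightarrow> 'c::finite \<Rightarrow> nat) \<Rightarrow> nat" where
  "prefix_sum t m = (\<Sum>I\<in>UNIV. \<Sum>i\<in>UNIV. if key I i < t then m I i else 0)"

lemma to_nat_less: "to_nat (i :: 'c::finite) < Suc (Max (range (to_nat :: 'c \<Rightarrow> nat)))"
  by (simp add: less_Suc_eq_le)

text \<open>A key has quotient \<open>to_nat I\<close> and remainder \<open>to_nat i\<close> modulo
  the row length, and both row boundaries are multiples of that length.\<close>

lemma key_less_iff:
  fixes I J :: "'r::finite" and i :: "'c::finite"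
  shows "key I i < row_start TYPE('c) J \<longleftrightarrow> to_nat I < to_nat J"
    and "key I i < row_end TYPE('c) J \<longleftrightarrow> to_nat I < Suc (to_nat J)"
proof -
  define B where "B = Suc (Max (range (to_nat :: 'c \<Rightarrow> nat)))"
  have "a * B + to_nat i < b * B \<longleftrightarrow> a < b" for a b
  proof -
    have "to_nat i < B" using to_nat_less[of i] by (simp add: B_def)
    then have "(a * B + to_nat i) div B = a" "0 < B" by simp_all
    then show ?thesis
      using div_less_iff_less_mult[of B "a * B + to_nat i" b] by simp
  qed
  then show "key I i < row_start TYPE('c) J \<longleftrightarrow> to_nat I < to_nat J"
    "key I i < row_end TYPE('c) J \<longleftrightarrow> to_nat I < Suc (to_nat J)"
    unfolding key_def row_start_def row_end_def B_def by blast+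
qed

lemma key_eq_iff: "key I i = key J j \<longleftrightarrow> I = J \<and> i = j"
proof
  assume eq: "key I i = key J j"
  have "to_nat I = to_nat J"
  proof (rule ccontr)
    assume "to_nat I \<noteq> to_nat J"
    then consider "to_nat I < to_nat J" | "to_nat J < to_nat I" by linarith
    then show False
      using key_less_iff(1)[of I i J] key_less_iff(1)[of J i J]
        key_less_iff(1)[of J j I] key_less_iff(1)[of I j I] eq
      by (cases) (auto simp: key_def)
  qed
  then show "I = J \<and> i = j" using eq by (auto simp: key_def)
qed simp

lemma prefix_sum_0 [simp]: "prefix_sum 0 m = 0"
  by (simp add: prefix_sum_def)

lemma prefix_sum_Suc:
  "prefix_sum (Suc t) m = prefix_sum t m + (\<Sum>I\<in>UNIV. \<Sum>i\<in>UNIV. if key I i = t then m I i else 0)"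
  unfolding prefix_sum_def sum.distrib[symmetric]
  by (intro sum.cong refl) (auto simp: less_Suc_eq)

lemma prefix_sum_Suc_key: "prefix_sum (Suc (key I i)) m = prefix_sum (key I i) m + m I i"
proof -
  have "(\<Sum>J\<in>UNIV. \<Sum>j\<in>UNIV. if key J j = key I i then m J j else 0)
      = (\<Sum>J\<in>UNIV. \<Sum>j\<in>UNIV. if j = i then if J = I then m J j else 0 else 0)"
    by (intro sum.cong refl) (auto simp: key_eq_iff)
  also have "\<dots> = m I i" by simp
  finally show ?thesis by (simp add: prefix_sum_Suc)
qed

lemma prefix_sum_Suc_no_key:
  "(\<And>(I::'r) (i::'c). key I i \<noteq> t) \<Longrightarrow> prefix_sum (Suc t) m = prefix_sum t m"
  for m :: "'r::finite \<Rightarrow> 'c::finite \<Rightarrow> nat"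
  by (simp add: prefix_sum_Suc)

lemma prefix_sum_inj:
  assumes "\<And>t. prefix_sum t m = prefix_sum t m'"
  shows "m = m'"
proof (intro ext)
  fix I i
  show "m I i = m' I i"
    using assms[of "Suc (key I i)"] assms[of "key I i"] by (simp add: prefix_sum_Suc_key)
qed

lemma prefix_sum_add: "prefix_sum t (\<lambda>I i. f I i + g I i) = prefix_sum t f + prefix_sum t g"
  unfolding prefix_sum_def sum.distrib[symmetric] by (intro sum.cong refl) auto

lemma prefix_sum_zero [simp]: "prefix_sum t (\<lambda>I i. 0) = 0"
  by (simp add: prefix_sum_def)

lemma prefix_sum_total: "prefix_sum t (total ms) = (\<Sum>m\<in>#ms. prefix_sum t m)"
  by (induction ms) (simp_all add: prefix_sum_add)

lemma prefix_sum_row_end: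
  fixes m :: "'r::finite \<Rightarrow> 'c::finite \<Rightarrow> nat"
  shows "prefix_sum (row_end TYPE('c) I) m = prefix_sum (row_start TYPE('c) I) m + row_sum m I"
proof -
  have "prefix_sum (row_end TYPE('c) I) m
      = (\<Sum>J\<in>UNIV. (if to_nat J < to_nat I then row_sum m J else 0) + (if J = I then row_sum m J else 0))"
    unfolding prefix_sum_def key_less_iff
    by (intro sum.cong refl) (auto simp: row_sum_def less_Suc_eq)
  also have "\<dots> = (\<Sum>J\<in>UNIV. (if to_nat J < to_nat I then row_sum m J else 0)) + row_sum m I"
    by (simp add: sum.distrib)
  also have "(\<Sum>J\<in>UNIV. (if to_nat J < to_nat I then row_sum m J else 0)) = prefix_sum (row_start TYPE('c) I) m"
    unfolding prefix_sum_def key_less_iff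
    by (intro sum.cong refl) (auto simp: row_sum_def)
  finally show ?thesis .
qed

lemma prefix_sum_const:
  fixes m :: "'r::finite \<Rightarrow> 'c::finite \<Rightarrow> nat"
  assumes "\<And>(I::'r) (i::'c). key I i < N" "N \<le> t"
  shows "prefix_sum t m = prefix_sum N m"
  by (simp add: prefix_sum_def assms(1) order_less_le_trans[OF assms])

lemma key_bounded: "\<exists>N. \<forall>(I::'r::finite) (i::'c::finite). key I i < N"
proof -
  have "finite (range (\<lambda>(I::'r, i::'c). key I i))" by simp
  then obtain N where "\<forall>k\<in>range (\<lambda>(I::'r, i::'c). key I i). k < N"
    using finite_nat_set_iff_bounded by blast
  then show ?thesis by (intro exI[of _ N]) auto
qed

lemma less_fun_nat_trichotomy:
  fixes f g :: "nat \<Rightarrow> 'a::linorder"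
  assumes "f \<noteq> g"
  shows "less_fun f g \<or> less_fun g f"
proof -
  obtain k where "f k \<noteq> g k" using assms by auto
  define q where "q = (LEAST k. f k \<noteq> g k)"
  have "f q \<noteq> g q" unfolding q_def by (rule LeastI) fact
  moreover have "f k = g k" if "k < q" for k
    using not_less_Least[of k "\<lambda>k. f k \<noteq> g k"] that by (auto simp: q_def)
  ultimately show ?thesis unfolding less_fun_def by (metis linorder_less_linear)
qed

lemma less_fun_add_iff: "less_fun (\<lambda>t. f t + h t) (\<lambda>t. g t + h t) \<longleftrightarrow> less_fun f g"
  for f g h :: "nat \<Rightarrow> nat"
  by (simp add: less_fun_def)

text \<open>This is the lexicographic order of the entries along \<open>key\<close>: prefix sums
  first differ just after the first entry that differs. In this form the order shares its data with
  \<open>interleaved\<close> and with the weights of monomials.\<close>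

definition mat_less :: "('r::finite \<Rightarrow> 'c::finite \<Rightarrow> nat) \<Rightarrow> ('r \<Rightarrow> 'c \<Rightarrow> nat) \<Rightarrow> bool" where
  "mat_less m m' \<longleftrightarrow> less_fun (\<lambda>t. prefix_sum t m) (\<lambda>t. prefix_sum t m')"

lemma mat_less_irrefl: "\<not> mat_less m m"
  by (simp add: mat_less_def less_fun_irrefl)

lemma mat_less_trans: "mat_less a b \<Longrightarrow> mat_less b c \<Longrightarrow> mat_less a c"
  unfolding mat_less_def by (rule less_fun_trans)

lemma mat_less_total: "a \<noteq> b \<Longrightarrow> mat_less a b \<or> mat_less b a"
  unfolding mat_less_def
  using less_fun_nat_trichotomy[of "\<lambda>t. prefix_sum t a" "\<lambda>t. prefix_sum t b"] prefix_sum_inj[of a b]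
  by (auto dest: fun_cong)

lemma mat_less_add_iff [simp]:
  "mat_less (\<lambda>I i. a I i + c I i) (\<lambda>I i. b I i + c I i) \<longleftrightarrow> mat_less a b"
  by (simp add: mat_less_def prefix_sum_add less_fun_add_iff)

lemma mat_less_asymp_transp: "asymp_on S mat_less" "transp_on S mat_less"
  unfolding asymp_on_def transp_on_def mat_less_def
  by (blast dest: less_fun_asym less_fun_trans)+

lemma mat_less_minimum:
  assumes "finite S" "S \<noteq> {}"
  shows "\<exists>m\<in>S. \<forall>m'\<in>S. \<not> mat_less m' m"
proof -
  show ?thesis
    using Finite_Set.bex_min_element[OF assms(1) mat_less_asymp_transp assms(2)] mat_less_irrefl
    by metis
qed

text \<open>The order is compatible with addition and cancellation, so lowering one member strictly
  lowers the total. Whether replacing members by smaller ones changed anything can therefore be read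
  off the totals.\<close>

lemma mat_less_total_mset:
  assumes "\<And>x. x \<in># A \<Longrightarrow> g x = f x \<or> mat_less (g x) (f x)"
  shows "total (image_mset g A) = total (image_mset f A) \<or>
    mat_less (total (image_mset g A)) (total (image_mset f A))"
    and "total (image_mset g A) = total (image_mset f A) \<Longrightarrow> x \<in># A \<Longrightarrow> g x = f x"
proof -
  have add2: "(\<lambda>I i. a I i + c I i) = (\<lambda>I i. b I i + d I i) \<and> a = b \<and> c = d \<or>
      mat_less (\<lambda>I i. a I i + c I i) (\<lambda>I i. b I i + d I i)"
    if "a = b \<or> mat_less a b" "c = d \<or> mat_less c d" for a b c d :: "'b \<Rightarrow> 'c \<Rightarrow> nat"
  proof (cases "a = b")
    case True
    then show ?thesis using that mat_less_add_iff[of c a d] by (auto simp: add.commute)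
  next
    case False
    then have "mat_less (\<lambda>I i. a I i + c I i) (\<lambda>I i. b I i + c I i)" using that by simp
    moreover have "c = d \<or> mat_less (\<lambda>I i. b I i + c I i) (\<lambda>I i. b I i + d I i)"
      using that mat_less_add_iff[of c b d] by (auto simp: add.commute)
    ultimately show ?thesis using mat_less_trans by blast
  qed
  have "(total (image_mset g A) = total (image_mset f A) \<and> (\<forall>x\<in>#A. g x = f x)) \<or>
    mat_less (total (image_mset g A)) (total (image_mset f A))"
    using assms
  proof (induction A)
    case (add x A)
    then have "(total (image_mset g A) = total (image_mset f A) \<and> (\<forall>x\<in>#A. g x = f x)) \<or>
        mat_less (total (image_mset g A)) (total (image_mset f A))"
      and "g x = f x \<or> mat_less (g x) (f x)"
      by auto
    with add2[of "g x" "f x" "total (image_mset g A)" "total (image_mset f A)"]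
      mat_less_irrefl[of "total (image_mset f A)"] mat_less_irrefl[of "f x"] show ?case
      by auto
  qed simp
  then show "total (image_mset g A) = total (image_mset f A) \<or>
    mat_less (total (image_mset g A)) (total (image_mset f A))"
    "total (image_mset g A) = total (image_mset f A) \<Longrightarrow> x \<in># A \<Longrightarrow> g x = f x"
    using mat_less_irrefl by metis+
qed

section \<open>Exchange moves and lexicographic minimality\<close>

lemma exchange_sums:
  assumes "\<And>I i. P I i \<le> M I i" "row_sum P = row_sum Q" "col_sum P = col_sum Q"
  shows "row_sum (\<lambda>I i. (M I i - P I i) + Q I i) = row_sum M"
    and "col_sum (\<lambda>I i. (M I i - P I i) + Q I i) = col_sum M"
proof -
  \<comment> \<open>Adding \<open>P\<close> back removes the truncated subtraction; both claims then
    follow by cancelling the equal sums of \<open>P\<close> and \<open>Q\<close>.\<close>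
  have *: "(\<lambda>I i. ((M I i - P I i) + Q I i) + P I i) = (\<lambda>I i. M I i + Q I i)"
    using assms(1) by (simp add: fun_eq_iff le_add_diff_inverse2 trans_le_add1)
  show "row_sum (\<lambda>I i. (M I i - P I i) + Q I i) = row_sum M"
    using arg_cong[OF *, of row_sum] assms(2) unfolding row_sum_simps(1) by (simp add: fun_eq_iff)
  show "col_sum (\<lambda>I i. (M I i - P I i) + Q I i) = col_sum M"
    using arg_cong[OF *, of col_sum] assms(3) unfolding col_sum_simps(1) by (simp add: fun_eq_iff)
qed

text \<open>Truncated differences count only the excess of \<open>M\<close> over \<open>M'\<close>.
  Removing \<open>P\<close> lowers it, and \<open>Q\<close> acts only where \<open>M\<close> is
  below \<open>M'\<close>, without overshooting, so it adds nothing. The total excess is the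
  induction measure for walking from \<open>M\<close> to \<open>M'\<close>.\<close>

lemma exchange_distance:
  fixes M M' :: "'r::finite \<Rightarrow> 'c::finite \<Rightarrow> nat"
  assumes P: "\<And>I i. P I i \<le> M I i - M' I i" and Q: "\<And>I i. Q I i \<le> M' I i - M I i"
    and "\<exists>I i. P I i > 0"
  shows "(M I i - P I i) + Q I i - M' I i \<le> M I i - M' I i"
    and "(\<Sum>I\<in>UNIV. \<Sum>i\<in>UNIV. (M I i - P I i) + Q I i - M' I i) < (\<Sum>I\<in>UNIV. \<Sum>i\<in>UNIV. M I i - M' I i)"
proof -
  define M1 where "M1 = (\<lambda>I i. (M I i - P I i) + Q I i)"
  have pt: "M1 I i - M' I i \<le> M I i - M' I i - P I i" for I i
    using P[of I i] Q[of I i] unfolding M1_def by linarith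
  have pt_le: "M1 I i - M' I i \<le> M I i - M' I i" for I i
    using pt[of I i] by linarith
  then show "(M I i - P I i) + Q I i - M' I i \<le> M I i - M' I i" by (simp add: M1_def)
  obtain I0 i0 where pos: "P I0 i0 > 0" using assms(3) by blast
  have "(\<Sum>I\<in>UNIV. \<Sum>i\<in>UNIV. M1 I i - M' I i) < (\<Sum>I\<in>UNIV. \<Sum>i\<in>UNIV. M I i - M' I i)"
  proof (rule sum_strict_mono_ex1)
    show "\<forall>I\<in>UNIV. (\<Sum>i\<in>UNIV. M1 I i - M' I i) \<le> (\<Sum>i\<in>UNIV. M I i - M' I i)"
      using pt_le by (auto intro: sum_mono)
    have "(\<Sum>i\<in>UNIV. M1 I0 i - M' I0 i) < (\<Sum>i\<in>UNIV. M I0 i - M' I0 i)"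
    proof (rule sum_strict_mono_ex1)
      show "\<forall>i\<in>UNIV. M1 I0 i - M' I0 i \<le> M I0 i - M' I0 i"
        using pt_le by blast
      show "\<exists>i\<in>UNIV. M1 I0 i - M' I0 i < M I0 i - M' I0 i"
        using pt[of I0 i0] pos P[of I0 i0] by (intro bexI[of _ i0]) auto
    qed simp
    then show "\<exists>I\<in>UNIV. (\<Sum>i\<in>UNIV. M1 I i - M' I i) < (\<Sum>i\<in>UNIV. M I i - M' I i)" by blast
  qed simp
  then show "(\<Sum>I\<in>UNIV. \<Sum>i\<in>UNIV. (M I i - P I i) + Q I i - M' I i) < (\<Sum>I\<in>UNIV. \<Sum>i\<in>UNIV. M I i - M' I i)"
    by (simp add: M1_def)
qed

text \<open>If the cycle found raises \<open>M\<close>, the raised matrix is still above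
  \<open>M'\<close> and has smaller excess over it, so induction applies. A cycle found later still
  removes only excess of the original \<open>M\<close>, because the excess shrinks entrywise. The
  part \<open>Q\<close> is only bounded by \<open>M'\<close>, which suffices to control its
  support.\<close>

lemma improving_cycle:
  fixes M M' :: "'r::finite \<Rightarrow> 'c::finite \<Rightarrow> nat"
  assumes "row_sum M = row_sum M'" "col_sum M = col_sum M'" "mat_less M' M"
  shows "\<exists>P Q. (\<forall>I i. P I i \<le> M I i - M' I i) \<and> (\<forall>I i. Q I i \<le> M' I i) \<and> row_sum P = row_sum Q \<and>
    col_sum P = col_sum Q \<and> (\<forall>I. row_sum P I \<le> 1) \<and> mat_less Q P"
  using assms
proof (induction "\<Sum>I\<in>UNIV. \<Sum>i\<in>UNIV. M I i - M' I i" arbitrary: M rule: less_induct)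
  case less
  have "M \<noteq> M'" using less.prems(3) mat_less_irrefl by blast
  then obtain P Q where PQ: "\<And>I i. P I i \<le> M I i - M' I i" "\<And>I i. Q I i \<le> M' I i - M I i"
    "\<exists>I i. P I i > 0" "row_sum P = row_sum Q" "col_sum P = col_sum Q" "\<And>I. row_sum P I \<le> 1"
    using exchange_cycle[OF less.prems(1,2)] by blast
  have le: "P I i \<le> M I i" for I i using PQ(1)[of I i] by linarith
  show ?case
  proof (cases "mat_less Q P")
    case True
    then show ?thesis using PQ
      by (intro exI[of _ P] exI[of _ Q]) (auto intro: order_trans[OF PQ(2)])
  next
    case False
    have "P \<noteq> Q"
    proof
      assume "P = Q"
      obtain I i where "P I i > 0" using PQ(3) by blast
      then show False using PQ(1)[of I i] PQ(2)[of I i] \<open>P = Q\<close> by auto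
    qed
    then have "mat_less P Q" using False mat_less_total by blast
    define M1 where "M1 = (\<lambda>I i. (M I i - P I i) + Q I i)"
    have M1: "(\<lambda>I i. M1 I i + P I i) = (\<lambda>I i. Q I i + M I i)"
      by (intro ext) (simp add: M1_def le le_add_diff_inverse2 trans_le_add1)
    have "mat_less (\<lambda>I i. P I i + M I i) (\<lambda>I i. M1 I i + P I i)"
      unfolding M1 using \<open>mat_less P Q\<close> by simp
    then have "mat_less M M1"
      using mat_less_add_iff[of M P M1] by (simp add: add.commute)
    then have "mat_less M' M1" using less.prems(3) mat_less_trans by blast
    have "row_sum M1 = row_sum M" "col_sum M1 = col_sum M"
      unfolding M1_def by (rule exchange_sums[OF le PQ(4,5)])+
    have dist: "M1 I i - M' I i \<le> M I i - M' I i"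
      "(\<Sum>I\<in>UNIV. \<Sum>i\<in>UNIV. M1 I i - M' I i) < (\<Sum>I\<in>UNIV. \<Sum>i\<in>UNIV. M I i - M' I i)" for I i
      unfolding M1_def by (rule exchange_distance[OF PQ(1-3)])+
    from less.hyps[OF dist(2)] obtain P' Q' where "\<forall>I i. P' I i \<le> M1 I i - M' I i" "\<forall>I i. Q' I i \<le> M' I i"
      "row_sum P' = row_sum Q'" "col_sum P' = col_sum Q'" "\<forall>I. row_sum P' I \<le> 1" "mat_less Q' P'"
      using less.prems \<open>row_sum M1 = row_sum M\<close> \<open>col_sum M1 = col_sum M\<close> \<open>mat_less M' M1\<close> by auto
    moreover from this(1) have "P' I i \<le> M I i - M' I i" for I i
      using dist(1) order_trans by blast
    ultimately show ?thesis by blast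
  qed
qed

definition lex_minimal :: "('r \<Rightarrow> 'c set) \<Rightarrow> ('r::finite \<Rightarrow> 'c::finite \<Rightarrow> nat) \<Rightarrow> bool" where
  "lex_minimal E M \<longleftrightarrow> (\<forall>M'\<in>transports E (row_sum M). col_sum M' = col_sum M \<longrightarrow> \<not> mat_less M' M)"

text \<open>The initial ideal of the toric ideal of a bipartite graph is squarefree: an improving cycle
  meets each row at most once, hence it only depends on the support.\<close>

lemma lex_minimal_support:
  assumes "lex_minimal E M" "M \<in> transports E (row_sum M)" "\<And>I i. M2 I i \<noteq> 0 \<Longrightarrow> M I i \<noteq> 0"
  shows "lex_minimal E M2"
  unfolding lex_minimal_def
proof (intro ballI impI notI)
  fix M' assume M': "M' \<in> transports E (row_sum M2)" "col_sum M' = col_sum M2" "mat_less M' M2"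
  then obtain P Q where PQ: "\<And>I i. P I i \<le> M2 I i - M' I i" "\<And>I i. Q I i \<le> M' I i"
    "row_sum P = row_sum Q" "col_sum P = col_sum Q" "\<And>I. row_sum P I \<le> 1" "mat_less Q P"
  proof -
    have "row_sum M2 = row_sum M'" using M'(1) by (auto simp: transports_def)
    from improving_cycle[OF this M'(2)[symmetric] M'(3)] show thesis using that by blast
  qed
  have le: "P I i \<le> M I i" for I i
  proof (cases "P I i = 0")
    case False
    then have "M I i \<noteq> 0" using PQ(1)[of I i] assms(3)[of I i] by auto
    moreover have "P I i \<le> 1" using order_trans[OF row_sum_ge PQ(5)] .
    ultimately show ?thesis by linarith
  qed simp
  define M1 where "M1 = (\<lambda>I i. (M I i - P I i) + Q I i)"
  have "row_sum M1 = row_sum M" "col_sum M1 = col_sum M"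
    unfolding M1_def by (rule exchange_sums[OF le PQ(3,4)])+
  moreover have "i \<in> E I" if "M1 I i \<noteq> 0" for I i
  proof -
    have "M I i \<noteq> 0 \<or> M' I i \<noteq> 0" using that PQ(2)[of I i] by (auto simp: M1_def)
    then show ?thesis using assms(2) M'(1) by (auto simp: transports_def)
  qed
  moreover have "mat_less M1 M"
  proof -
    have "(\<lambda>I i. M1 I i + P I i) = (\<lambda>I i. Q I i + M I i)"
      by (intro ext) (simp add: M1_def le le_add_diff_inverse2 trans_le_add1)
    moreover have "mat_less (\<lambda>I i. Q I i + M I i) (\<lambda>I i. P I i + M I i)" using PQ(6) by simp
    ultimately show ?thesis using mat_less_add_iff[of M1 P M] by (simp add: add.commute)
  qed
  ultimately show False using assms(1) unfolding lex_minimal_def transports_def by auto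
qed

section \<open>Balanced multisets of matrices\<close>

definition interleaved :: "('r::finite \<Rightarrow> 'c::finite \<Rightarrow> nat) \<Rightarrow> ('r \<Rightarrow> 'c \<Rightarrow> nat) \<Rightarrow> bool" where
  "interleaved a b \<longleftrightarrow> (\<forall>t. prefix_sum t a \<le> prefix_sum t b \<and> prefix_sum t b \<le> prefix_sum t a + 1)"

text \<open>Stated for the underlying set, so that multiplicities do not matter and the property
  passes to subsets: for monomials it becomes a condition on the support.\<close>

definition balanced :: "('r::finite \<Rightarrow> 'c::finite \<Rightarrow> nat) set \<Rightarrow> bool" where
  "balanced A \<longleftrightarrow> (\<forall>a\<in>A. \<forall>b\<in>A. interleaved a b \<or> interleaved b a)"

text \<open>The squares compare two positions because squares of single prefix sums are too coarse:
  if those of \<open>a\<close> and \<open>b\<close> differ by 1 at one position, by -1 at another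
  and by 0 elsewhere, sorting only swaps the values at some positions and leaves their squares
  unchanged in sum. \<open>N\<close> will exceed all keys, so that no position is missed.\<close>

definition energy :: "nat \<Rightarrow> ('r::finite \<Rightarrow> 'c::finite \<Rightarrow> nat) \<Rightarrow> nat" where
  "energy N m = nat (\<Sum>s\<le>N. \<Sum>t\<le>N. (int (prefix_sum s m) - int (prefix_sum t m))\<^sup>2)"

lemma int_energy: "int (energy N m) = (\<Sum>s\<le>N. \<Sum>t\<le>N. (int (prefix_sum s m) - int (prefix_sum t m))\<^sup>2)"
  unfolding energy_def by (intro int_nat_eq[THEN trans]) (simp add: sum_nonneg)

text \<open>Halving the prefix sums of \<open>a + b\<close> with rounding up and down.\<close>

lemma sort_pair:
  fixes a b :: "'r::finite \<Rightarrow> 'c::finite \<Rightarrow> nat"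
  assumes ab: "a \<in> transports E y" "b \<in> transports E y"
  obtains c d where "c \<in> transports E y" "d \<in> transports E y"
    "\<And>I i. c I i + d I i = a I i + b I i" "interleaved d c"
proof -
  define S where "S t = prefix_sum t a + prefix_sum t b" for t
  have S0: "S 0 = 0" by (simp add: S_def)
  have S_key: "S (Suc (key I i)) = S (key I i) + (a I i + b I i)" for I i
    by (simp add: S_def prefix_sum_Suc_key)
  have S_no: "S (Suc t) = S t" if "\<And>(I::'r) (i::'c). key I i \<noteq> t" for t
    using that by (simp add: S_def prefix_sum_Suc_no_key)
  \<comment> \<open>Halving with either rounding turns a shift by the even number
    \<open>2 * y I\<close> into a shift by \<open>y I\<close>, so both halves get the correct row
    sums.\<close>
  have S_row: "S (row_end TYPE('c) I) = S (row_start TYPE('c) I) + 2 * y I" for I :: 'r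
    using ab by (simp add: S_def prefix_sum_row_end transports_def)
  \<comment> \<open>\<open>e\<close> selects the rounding: 0 down, 1 up. The entries are increments
    of the halved sums, which are monotone, so the subtraction never truncates.\<close>
  define half where "half e m \<longleftrightarrow> (\<forall>I i. m I i = (S (Suc (key I i)) + e) div 2 - (S (key I i) + e) div 2)"
    for e and m :: "'r \<Rightarrow> 'c \<Rightarrow> nat"
  have half: "prefix_sum t m = (S t + e) div 2" if "half e m" "e \<le> 1" for e m t
  proof (induction t)
    case 0
    then show ?case using that by (simp add: S0)
  next
    case (Suc t)
    show ?case
    proof (cases "\<exists>(I::'r) (i::'c). key I i = t")
      case True
      then obtain I :: 'r and i :: 'c where t: "key I i = t" by blast
      have "(S t + e) div 2 \<le> (S (Suc t) + e) div 2"
        using S_key[of I i] t by (intro div_le_mono) simp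
      moreover have "m I i = (S (Suc t) + e) div 2 - (S t + e) div 2"
        using that(1) t by (simp add: half_def)
      ultimately show ?thesis using prefix_sum_Suc_key[of I i m] t Suc by simp
    next
      case False
      then show ?thesis using S_no[of t] prefix_sum_Suc_no_key[of t m] Suc by simp
    qed
  qed
  have half_transport: "m \<in> transports E y" if "half e m" "e \<le> 1" for e m
  proof -
    have "i \<in> E I" if "m I i \<noteq> 0" for I i
    proof -
      have "a I i + b I i \<noteq> 0"
        using that \<open>half e m\<close> S_key[of I i] by (intro notI) (simp add: half_def)
      then show ?thesis using ab by (auto simp: transports_def)
    qed
    moreover have "row_sum m I = y I" for I
      using prefix_sum_row_end[where 'c='c, of I m] S_row[of I] by (simp add: half[OF that])
    ultimately show ?thesis by (auto simp: transports_def)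
  qed
  define c where "c I i = (S (Suc (key I i)) + 1) div 2 - (S (key I i) + 1) div 2" for I :: 'r and i :: 'c
  define d where "d I i = (S (Suc (key I i)) + 0) div 2 - (S (key I i) + 0) div 2" for I :: 'r and i :: 'c
  have c: "half 1 c" and d: "half 0 d" by (simp_all add: half_def c_def d_def)
  show ?thesis
  proof (rule that[of c d])
    show "c \<in> transports E y" "d \<in> transports E y"
      using half_transport[OF c] half_transport[OF d] by simp_all
    have ps: "prefix_sum t c = (S t + 1) div 2" "prefix_sum t d = S t div 2" for t
      using half[OF c, of t] half[OF d, of t] by simp_all
    have halves: "n div 2 \<le> (n + 1) div 2 \<and> (n + 1) div 2 \<le> n div 2 + 1"
      "(n + 1) div 2 + n div 2 = n" for n :: nat
      by presburger+
    show "interleaved d c" unfolding interleaved_def ps using halves(1) by blast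
    show "c I i + d I i = a I i + b I i" for I i
    proof -
      have "prefix_sum t c + prefix_sum t d = S t" for t unfolding ps by (rule halves(2))
      from this[of "key I i"] this[of "Suc (key I i)"] show ?thesis
        using S_key[of I i] by (simp add: prefix_sum_Suc_key)
    qed
  qed
qed

text \<open>\<open>x\<close> and \<open>z\<close> have equal parity, and -1, 0 and 1 have the least
  absolute value within their parity class.\<close>

lemma square_parity_mono:
  fixes x z :: int
  assumes "x = z + 2 * k" "\<bar>z\<bar> \<le> 1"
  shows "z\<^sup>2 \<le> x\<^sup>2" "\<bar>x\<bar> \<ge> 2 \<Longrightarrow> z\<^sup>2 < x\<^sup>2"
proof -
  have "\<bar>z\<bar> \<le> \<bar>x\<bar>" using assms by presburger
  then show "z\<^sup>2 \<le> x\<^sup>2" by (simp add: abs_le_square_iff)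
  assume "\<bar>x\<bar> \<ge> 2"
  then have "\<bar>z\<bar> < \<bar>x\<bar>" using assms by linarith
  then show "z\<^sup>2 < x\<^sup>2" by (simp add: abs_square_less_1 power2_strict_mono)
qed

text \<open>By the parallelogram law each term of the energy splits into a part given by the common
  sum of the pair and the square of \<open>D s - D t\<close>. Sorting keeps the parity of that
  difference and brings its absolute value to at most 1, so no term grows.\<close>

lemma energy_sort_less:
  fixes a b c d :: "'r::finite \<Rightarrow> 'c::finite \<Rightarrow> nat"
  assumes N: "\<And>(I::'r) (i::'c). key I i < N"
    and sum: "\<And>I i. c I i + d I i = a I i + b I i"
    and cd: "interleaved d c" and ab: "\<not> interleaved a b" "\<not> interleaved b a"
  shows "energy N c + energy N d < energy N a + energy N b"
proof -
  let ?p = "\<lambda>t (m :: 'r \<Rightarrow> 'c \<Rightarrow> nat). int (prefix_sum t m)"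
  define D where "D t = ?p t a - ?p t b" for t
  define D' where "D' t = ?p t c - ?p t d" for t
  define spread where "spread u v s t = (?p s u - ?p t u)\<^sup>2 + (?p s v - ?p t v)\<^sup>2"
    for u v :: "'r \<Rightarrow> 'c \<Rightarrow> nat" and s t
  have "(\<lambda>I i. c I i + d I i) = (\<lambda>I i. a I i + b I i)" using sum by simp
  then have "prefix_sum t c + prefix_sum t d = prefix_sum t a + prefix_sum t b" for t
    unfolding prefix_sum_add[symmetric] by simp
  then have S: "?p t c + ?p t d = ?p t a + ?p t b" for t
    using of_nat_add by metis
  have D'01: "0 \<le> D' t" "D' t \<le> 1" for t
  proof -
    have "prefix_sum t d \<le> prefix_sum t c \<and> prefix_sum t c \<le> prefix_sum t d + 1"
      using cd by (simp add: interleaved_def)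
    then show "0 \<le> D' t" "D' t \<le> 1" unfolding D'_def by linarith+
  qed
  have par: "D s - D t = (D' s - D' t) + 2 * ((?p t b - ?p t d) - (?p s b - ?p s d))" for s t
  proof -
    have *: "(a - b) - (a' - b') = ((c - d) - (c' - d')) + 2 * ((b' - d') - (b - d))"
      if "c + d = a + b" "c' + d' = a' + b'" for a b c d a' b' c' d' :: int
      using that by algebra
    show ?thesis unfolding D_def D'_def by (rule *[OF S S])
  qed
  have parallelogram: "2 * ((a - a')\<^sup>2 + (b - b')\<^sup>2) = (a + b - (a' + b'))\<^sup>2 + ((a - b) - (a' - b'))\<^sup>2"
    for a a' b b' :: int
    by algebra
  have spread_ab: "2 * spread a b s t = (?p s a + ?p s b - (?p t a + ?p t b))\<^sup>2 + (D s - D t)\<^sup>2" for s t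
    unfolding spread_def D_def by (rule parallelogram)
  have spread_cd: "2 * spread c d s t = (?p s a + ?p s b - (?p t a + ?p t b))\<^sup>2 + (D' s - D' t)\<^sup>2" for s t
    unfolding S[symmetric] spread_def D'_def by (rule parallelogram)
  have abs: "\<bar>D' s - D' t\<bar> \<le> 1" for s t using D'01[of s] D'01[of t] by linarith
  have le: "spread c d s t \<le> spread a b s t" for s t
    using square_parity_mono(1)[OF par abs, of s t] spread_ab[of s t] spread_cd[of s t] by linarith
  \<comment> \<open>Since \<open>D 0 = 0\<close>, one value of absolute value at least 2 suffices.
    Otherwise the failure of both interleavings gives the values -1 and 1 at two positions. Clipping
    a position at \<open>N\<close> keeps \<open>D\<close>, as prefix sums are constant from there
    on.\<close>
  have "\<exists>s\<le>N. \<exists>t\<le>N. \<bar>D s - D t\<bar> \<ge> 2"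
  proof -
    have D_min: "D (min t N) = D t" for t
      using prefix_sum_const[OF N, where t = t and m = a] prefix_sum_const[OF N, where t = t and m = b]
      by (auto simp: D_def min_def)
    obtain t where "\<not> (prefix_sum t b \<le> prefix_sum t a \<and> prefix_sum t a \<le> prefix_sum t b + 1)"
      using ab(2) unfolding interleaved_def by blast
    then have t: "D t < 0 \<or> D t > 1" unfolding D_def by linarith
    obtain t' where "\<not> (prefix_sum t' a \<le> prefix_sum t' b \<and> prefix_sum t' b \<le> prefix_sum t' a + 1)"
      using ab(1) unfolding interleaved_def by blast
    then have t': "D t' > 0 \<or> D t' < -1" unfolding D_def by linarith
    have D0: "D 0 = 0" by (simp add: D_def)
    have "\<exists>s u. \<bar>D s - D u\<bar> \<ge> 2"
    proof (cases "\<bar>D t - D 0\<bar> \<ge> 2 \<or> \<bar>D t' - D 0\<bar> \<ge> 2")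
      case False
      then have "\<bar>D t - D t'\<bar> \<ge> 2" using t t' D0 by linarith
      then show ?thesis by blast
    qed blast
    then obtain s u where "\<bar>D s - D u\<bar> \<ge> 2" by blast
    then have "\<bar>D (min s N) - D (min u N)\<bar> \<ge> 2" by (simp only: D_min)
    then show ?thesis using min.cobounded2 by blast
  qed
  then obtain s t where st: "s \<le> N" "t \<le> N" "\<bar>D s - D t\<bar> \<ge> 2" by blast
  have lt: "spread c d s t < spread a b s t"
    using square_parity_mono(2)[OF par abs st(3)] spread_ab[of s t] spread_cd[of s t] by linarith
  have "(\<Sum>s\<le>N. \<Sum>t\<le>N. spread c d s t) < (\<Sum>s\<le>N. \<Sum>t\<le>N. spread a b s t)"
  proof (rule sum_strict_mono_ex1)
    show "\<forall>x\<in>{..N}. (\<Sum>t\<le>N. spread c d x t) \<le> (\<Sum>t\<le>N. spread a b x t)"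
      by (auto intro: sum_mono le)
    have "(\<Sum>t\<le>N. spread c d s t) < (\<Sum>t\<le>N. spread a b s t)"
      by (rule sum_strict_mono_ex1) (use le lt st in auto)
    then show "\<exists>x\<in>{..N}. (\<Sum>t\<le>N. spread c d x t) < (\<Sum>t\<le>N. spread a b x t)"
      using st(1) by blast
  qed simp
  then have "int (energy N c) + int (energy N d) < int (energy N a) + int (energy N b)"
    by (simp add: int_energy spread_def sum.distrib)
  then show ?thesis by linarith
qed

text \<open>The lexicographically largest member serves: a member not interleaved below it would lie
  pointwise above it, hence also lexicographically above it.\<close>

lemma balanced_top:
  assumes "balanced (set_mset A)" "A \<noteq> {#}"
  shows "\<exists>a\<in>#A. \<forall>m\<in>#A. interleaved m a"
proof -
  have "set_mset A \<noteq> {}" using assms(2) by simp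
  then obtain a where a: "a \<in># A" "\<And>b. b \<in># A \<Longrightarrow> \<not> mat_less a b"
    using Finite_Set.bex_max_element[OF finite_set_mset mat_less_asymp_transp] mat_less_irrefl by metis
  have "interleaved m a" if "m \<in># A" for m
  proof (rule ccontr)
    assume "\<not> interleaved m a"
    then have "interleaved a m" "a \<noteq> m"
      using assms(1) a(1) that by (auto simp: balanced_def interleaved_def)
    moreover from this have "mat_less m a" using a(2)[OF that] mat_less_total by blast
    ultimately show False
      unfolding mat_less_def less_fun_def interleaved_def by (meson leD)
  qed
  then show ?thesis using a(1) by blast
qed

text \<open>Each member falls short of \<open>a\<close> by 0 or 1 at position \<open>t\<close>. The
  second bound is strict because one copy of \<open>a\<close> itself has no shortfall.\<close>

lemma top_prefix_sum_bounds:
  assumes "a \<in># A" "\<And>m. m \<in># A \<Longrightarrow> interleaved m a"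
  shows "prefix_sum t (total A) \<le> size A * prefix_sum t a"
    and "size A * prefix_sum t a < prefix_sum t (total A) + size A"
proof -
  obtain B where B: "A = add_mset a B" using assms(1) by (meson mset_add)
  have "\<And>m. m \<in># B \<Longrightarrow> interleaved m a" using assms(2) B by simp
  then have "(\<Sum>m\<in>#B. prefix_sum t m) \<le> size B * prefix_sum t a \<and>
      size B * prefix_sum t a \<le> (\<Sum>m\<in>#B. prefix_sum t m) + size B"
  proof (induction B)
    case (add m B)
    then have "interleaved m a" by simp
    then have "prefix_sum t m \<le> prefix_sum t a \<and> prefix_sum t a \<le> prefix_sum t m + 1"
      by (simp add: interleaved_def)
    moreover have "(\<Sum>m\<in>#B. prefix_sum t m) \<le> size B * prefix_sum t a \<and>
      size B * prefix_sum t a \<le> (\<Sum>m\<in>#B. prefix_sum t m) + size B" using add by simp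
    ultimately show ?case by simp
  qed simp
  then show "prefix_sum t (total A) \<le> size A * prefix_sum t a"
    "size A * prefix_sum t a < prefix_sum t (total A) + size A"
    by (simp_all add: B prefix_sum_add prefix_sum_total)
qed

text \<open>The largest member of a balanced multiset is determined: its prefix sums are those of the
  total, divided by the size and rounded up.\<close>

lemma balanced_unique:
  assumes "size A = size B" "total A = total B" "balanced (set_mset A)" "balanced (set_mset B)"
  shows "A = B"
  using assms
proof (induction "size A" arbitrary: A B)
  case 0
  then show ?case by simp
next
  case (Suc n)
  have "A \<noteq> {#}" "B \<noteq> {#}" using Suc by auto
  obtain a where a: "a \<in># A" "\<And>m. m \<in># A \<Longrightarrow> interleaved m a"
    using balanced_top[OF Suc.prems(3) \<open>A \<noteq> {#}\<close>] by blast
  obtain b where b: "b \<in># B" "\<And>m. m \<in># B \<Longrightarrow> interleaved m b"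
    using balanced_top[OF Suc.prems(4) \<open>B \<noteq> {#}\<close>] by blast
  have le: "p \<le> q" if "k * p < T + k" "T \<le> k * q" for k p q T :: nat
  proof -
    have "k * p < k * Suc q" using that by simp
    then show ?thesis unfolding mult_less_cancel1 by simp
  qed
  have "prefix_sum t a = prefix_sum t b" for t
    using le[OF top_prefix_sum_bounds(2)[OF a, of t]] le[OF top_prefix_sum_bounds(2)[OF b, of t]]
      top_prefix_sum_bounds(1)[OF a, of t] top_prefix_sum_bounds(1)[OF b, of t] Suc.prems(1,2)
    by (auto intro!: antisym)
  then have "a = b" by (rule prefix_sum_inj)
  obtain A' B' where AB: "A = add_mset a A'" "B = add_mset a B'"
    using a(1) b(1) \<open>a = b\<close> by (meson mset_add)
  have "A' = B'"
  proof (rule Suc.hyps(1))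
    show "n = size A'" using Suc.hyps(2) AB by simp
    show "size A' = size B'" using Suc.prems(1) AB by simp
    show "total A' = total B'" using Suc.prems(2) AB by (simp add: fun_eq_iff)
    show "balanced (set_mset A')" "balanced (set_mset B')"
      using Suc.prems(3,4) AB by (auto simp: balanced_def)
  qed
  then show ?case using AB by simp
qed

text \<open>Sorting a pair that is not interleaved lowers the energy, so repeated sorting ends.
  \<open>R\<close> is abstract so that the congruence modulo quadrics only has to be checked for one
  replaced pair.\<close>

lemma balancing:
  fixes R :: "('r::finite \<Rightarrow> 'c::finite \<Rightarrow> nat) multiset \<Rightarrow> ('r \<Rightarrow> 'c \<Rightarrow> nat) multiset \<Rightarrow> bool"
  assumes "reflp R" "transp R"
    and step: "\<And>A a b c d. {a, b, c, d} \<subseteq> transports E y \<Longrightarrow> set_mset A \<subseteq> transports E y \<Longrightarrow>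
      (\<And>I i. c I i + d I i = a I i + b I i) \<Longrightarrow> R (A + {#a, b#}) (A + {#c, d#})"
    and "set_mset A \<subseteq> transports E y"
  shows "\<exists>B. R A B \<and> set_mset B \<subseteq> transports E y \<and> size B = size A \<and> total B = total A \<and> balanced (set_mset B)"
proof -
  obtain N where N: "\<And>(I::'r) (i::'c). key I i < N" using key_bounded by blast
  show ?thesis
    using assms(4)
  proof (induction "\<Sum>m\<in>#A. energy N m" arbitrary: A rule: less_induct)
    case less
    show ?case
    proof (cases "balanced (set_mset A)")
      case True
      then show ?thesis using less.prems \<open>reflp R\<close> by (intro exI[of _ A]) (auto simp: reflp_def)
    next
      case False
      then obtain a b where ab: "a \<in># A" "b \<in># A" "\<not> interleaved a b" "\<not> interleaved b a"
        unfolding balanced_def by blast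
      have "a \<noteq> b" using ab(3) by (auto simp: interleaved_def)
      obtain A1 where A1: "A = add_mset a A1" using ab(1) by (meson mset_add)
      then have "b \<in># A1" using ab(2) \<open>a \<noteq> b\<close> by simp
      then obtain A' where "A1 = add_mset b A'" by (meson mset_add)
      then have A': "A = A' + {#a, b#}" using A1 by simp
      have tr: "a \<in> transports E y" "b \<in> transports E y" "set_mset A' \<subseteq> transports E y"
        using less.prems A' by auto
      obtain c d where cd: "c \<in> transports E y" "d \<in> transports E y"
        "\<And>I i. c I i + d I i = a I i + b I i" "interleaved d c"
        using sort_pair[OF tr(1,2)] by blast
      let ?B = "A' + {#c, d#}"
      have "energy N c + energy N d < energy N a + energy N b"
        by (rule energy_sort_less[OF N cd(3,4) ab(3,4)])
      then have "(\<Sum>m\<in>#?B. energy N m) < (\<Sum>m\<in>#A. energy N m)" by (simp add: A')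
      moreover have "set_mset ?B \<subseteq> transports E y" using tr cd by simp
      ultimately obtain C where C: "R ?B C" "set_mset C \<subseteq> transports E y" "size C = size ?B"
        "total C = total ?B" "balanced (set_mset C)"
        using less.hyps by blast
      have "R A ?B" unfolding A' by (rule step) (use tr cd in auto)
      then have "R A C" using C(1) \<open>transp R\<close> by (blast dest: transpD)
      moreover have "total ?B = total A"
        using cd(3) by (simp add: A' fun_eq_iff add.assoc[symmetric])
      ultimately show ?thesis using C A' by (intro exI[of _ C]) simp
    qed
  qed
qed

section \<open>Lattice points of the polytope\<close>

definition int_cols :: "('r::finite \<Rightarrow> 'n::finite \<Rightarrow> nat) \<Rightarrow> int ^ 'n" where
  "int_cols m = (\<chi> i. int (col_sum m i))"

text \<open>Rows are indexed by all subsets of \<open>[n]\<close>; setting \<open>y\<close> to \<open>0\<close> at the empty set makes that row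
  harmless.\<close>

abbreviation subset_transports :: "('n::finite set \<Rightarrow> nat) \<Rightarrow> ('n set \<Rightarrow> 'n \<Rightarrow> nat) set" where
  "subset_transports y \<equiv> transports (\<lambda>I. I) (y({} := 0))"

lemma int_cols_add: "int_cols (\<lambda>I i. a I i + b I i) = int_cols a + int_cols b"
  by (simp add: int_cols_def vec_eq_iff col_sum_simps)

lemma int_cols_zero: "int_cols (\<lambda>I i. 0) = 0"
  by (simp add: int_cols_def vec_eq_iff col_sum_simps)

lemma int_cols_eq_iff: "int_cols a = int_cols b \<longleftrightarrow> col_sum a = col_sum b"
  by (auto simp: int_cols_def vec_eq_iff)

lemma int_cols_total: "int_cols (total ms) = (\<Sum>m\<in>#ms. int_cols m)"
  by (induction ms) (simp_all add: int_cols_add int_cols_zero)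

lemma coord_simplex_coordinates:
  fixes x :: "real ^ 'n::finite"
  assumes "x \<in> coord_simplex I"
  shows "x $ i \<ge> 0" "i \<notin> I \<Longrightarrow> x $ i = 0" "I \<subseteq> A \<Longrightarrow> (\<Sum>i\<in>A. x $ i) = 1"
proof -
  let ?S = "{x :: real ^ 'n. (\<forall>i. 0 \<le> x $ i) \<and> (\<forall>i. i \<notin> I \<longrightarrow> x $ i = 0) \<and> (\<Sum>i\<in>UNIV. x $ i) = 1}"
  have "convex ?S"
    unfolding convex_def
    by (auto simp: sum.distrib sum_distrib_left[symmetric])
  moreover have "(\<lambda>i. axis i 1) ` I \<subseteq> ?S"
    by (auto simp: axis_def)
  ultimately have x: "x \<in> ?S"
    using assms hull_minimal[of "(\<lambda>i. axis i 1) ` I" ?S convex] unfolding coord_simplex_def by blast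
  then show "x $ i \<ge> 0" "i \<notin> I \<Longrightarrow> x $ i = 0" by blast+
  assume "I \<subseteq> A"
  then have "(\<Sum>i\<in>A. x $ i) = (\<Sum>i\<in>UNIV. x $ i)"
    using x by (intro sum.mono_neutral_left) auto
  then show "(\<Sum>i\<in>A. x $ i) = 1" using x by simp
qed

lemma Y_polytope_eq:
  "Y_polytope y = {\<Sum>I\<in>{I. I \<noteq> {}}. real (y I) *\<^sub>R s I | s. \<forall>I. I \<noteq> {} \<longrightarrow> s I \<in> coord_simplex I}"
proof -
  have "Y_polytope y = {sum x {I. I \<noteq> {}} | x. \<forall>I\<in>{I. I \<noteq> {}}. x I \<in> dilate (real (y I)) (coord_simplex I)}"
    unfolding Y_polytope_def by (rule set_sum_alt) simp
  also have "\<dots> = {\<Sum>I\<in>{I. I \<noteq> {}}. real (y I) *\<^sub>R s I | s. \<forall>I. I \<noteq> {} \<longrightarrow> s I \<in> coord_simplex I}"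
  proof (intro equalityI subsetI)
    fix v assume "v \<in> {sum x {I. I \<noteq> {}} | x. \<forall>I\<in>{I. I \<noteq> {}}. x I \<in> dilate (real (y I)) (coord_simplex I)}"
    then obtain x where x: "v = sum x {I. I \<noteq> {}}"
      "\<forall>I\<in>{I. I \<noteq> {}}. x I \<in> dilate (real (y I)) (coord_simplex I)"
      by blast
    from x(2) have "\<forall>I. I \<noteq> {} \<longrightarrow> (\<exists>s. s \<in> coord_simplex I \<and> x I = real (y I) *\<^sub>R s)"
      by (auto simp: dilate_def)
    then obtain s where "\<And>I. I \<noteq> {} \<Longrightarrow> s I \<in> coord_simplex I \<and> x I = real (y I) *\<^sub>R s I" by metis
    then show "v \<in> {\<Sum>I\<in>{I. I \<noteq> {}}. real (y I) *\<^sub>R s I | s. \<forall>I. I \<noteq> {} \<longrightarrow> s I \<in> coord_simplex I}"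
      using x(1) by (intro CollectI exI[of _ s]) (auto intro: sum.cong)
  next
    fix v assume "v \<in> {\<Sum>I\<in>{I. I \<noteq> {}}. real (y I) *\<^sub>R s I | s. \<forall>I. I \<noteq> {} \<longrightarrow> s I \<in> coord_simplex I}"
    then obtain s where "v = (\<Sum>I\<in>{I. I \<noteq> {}}. real (y I) *\<^sub>R s I)" "\<forall>I. I \<noteq> {} \<longrightarrow> s I \<in> coord_simplex I"
      by blast
    then show "v \<in> {sum x {I. I \<noteq> {}} | x. \<forall>I\<in>{I. I \<noteq> {}}. x I \<in> dilate (real (y I)) (coord_simplex I)}"
      by (intro CollectI exI[of _ "\<lambda>I. real (y I) *\<^sub>R s I"]) (auto simp: dilate_def)
  qed
  finally show ?thesis .
qed

text \<open>From left to right, Rado's condition holds for a set \<open>A\<close> because a point of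
  the simplex of \<open>I\<close> has nonnegative coordinates, of sum 1 over \<open>A\<close> when
  \<open>I \<subseteq> A\<close>. From right to left, each row divided by its sum is a point of its
  simplex.\<close>

lemma lattice_points_dilate:
  fixes y :: "'n::finite set \<Rightarrow> nat"
  assumes "k > 0"
  shows "lattice_points (dilate (real k) (Y_polytope y)) = int_cols ` transports (\<lambda>I. I) (\<lambda>I. k * (y({} := 0)) I)"
proof (intro equalityI subsetI)
  fix \<alpha> assume "\<alpha> \<in> lattice_points (dilate (real k) (Y_polytope y))"
  then obtain s where s: "\<And>I. I \<noteq> {} \<Longrightarrow> s I \<in> coord_simplex I"
    and \<alpha>: "real_vec \<alpha> = real k *\<^sub>R (\<Sum>I\<in>{I. I \<noteq> {}}. real (y I) *\<^sub>R s I)"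
    by (auto simp: lattice_points_def dilate_def Y_polytope_eq)
  have \<alpha>_i: "real_of_int (\<alpha> $ i) = real k * (\<Sum>I\<in>{I. I \<noteq> {}}. real (y I) * s I $ i)" for i
    using arg_cong[OF \<alpha>, of "\<lambda>v. v $ i"] by (simp add: real_vec_def)
  have "0 \<le> real_of_int (\<alpha> $ i)" for i
    unfolding \<alpha>_i using coord_simplex_coordinates(1)[OF s] by (intro mult_nonneg_nonneg sum_nonneg) auto
  then have pos: "0 \<le> \<alpha> $ i" for i by simp
  define \<beta> where "\<beta> i = nat (\<alpha> $ i)" for i
  have sum_\<beta>: "real (sum \<beta> A) = (\<Sum>I\<in>{I. I \<noteq> {}}. real k * real (y I) * (\<Sum>i\<in>A. s I $ i))" for A
  proof -
    have "real (sum \<beta> A) = (\<Sum>i\<in>A. real_of_int (\<alpha> $ i))" using pos by (simp add: \<beta>_def)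
    also have "\<dots> = (\<Sum>i\<in>A. \<Sum>I\<in>{I. I \<noteq> {}}. real k * real (y I) * s I $ i)"
      unfolding \<alpha>_i by (simp add: sum_distrib_left mult.assoc)
    also have "\<dots> = (\<Sum>I\<in>{I. I \<noteq> {}}. real k * real (y I) * (\<Sum>i\<in>A. s I $ i))"
      unfolding sum_distrib_left by (rule sum.swap)
    finally show ?thesis .
  qed
  have sum_y: "real (\<Sum>I | I \<subseteq> A. k * (y({} := 0)) I) = (\<Sum>I\<in>{I. I \<noteq> {}}. if I \<subseteq> A then real k * real (y I) else 0)" for A
  proof -
    have "real (\<Sum>I | I \<subseteq> A. k * (y({} := 0)) I) = (\<Sum>I | I \<subseteq> A. real k * real ((y({} := 0)) I))"
      by simp
    also have "\<dots> = (\<Sum>I | I \<noteq> {} \<and> I \<subseteq> A. real k * real (y I))"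
      by (rule sum.mono_neutral_cong_right) auto
    also have "\<dots> = (\<Sum>I\<in>{I. I \<noteq> {}}. if I \<subseteq> A then real k * real (y I) else 0)"
      by (simp add: sum.If_cases Collect_conj_eq)
    finally show ?thesis .
  qed
  have "\<exists>m\<in>transports (\<lambda>I. I) (\<lambda>I. k * (y({} := 0)) I). col_sum m = \<beta>"
  proof (rule transport_exists)
    fix A
    have "real (\<Sum>I | I \<subseteq> A. k * (y({} := 0)) I) \<le> real (sum \<beta> A)"
      unfolding sum_\<beta> sum_y
    proof (rule sum_mono)
      fix I :: "'n set" assume I: "I \<in> {I. I \<noteq> {}}"
      then have "0 \<le> (\<Sum>i\<in>A. s I $ i)"
        using coord_simplex_coordinates(1)[OF s] by (intro sum_nonneg) auto
      then show "(if I \<subseteq> A then real k * real (y I) else 0) \<le> real k * real (y I) * (\<Sum>i\<in>A. s I $ i)"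
        using coord_simplex_coordinates(3)[OF s, of I A] I by auto
    qed
    then show "(\<Sum>I | I \<subseteq> A. k * (y({} := 0)) I) \<le> sum \<beta> A" by (simp only: of_nat_le_iff)
  next
    have "real (\<Sum>I | I \<subseteq> UNIV. k * (y({} := 0)) I) = real (sum \<beta> UNIV)"
      unfolding sum_\<beta> sum_y using coord_simplex_coordinates(3)[OF s subset_UNIV] by (intro sum.cong) auto
    then show "(\<Sum>I\<in>UNIV. k * (y({} := 0)) I) = sum \<beta> UNIV" by (simp only: of_nat_eq_iff) simp
  qed
  then obtain m where "m \<in> transports (\<lambda>I. I) (\<lambda>I. k * (y({} := 0)) I)" "col_sum m = \<beta>" by blast
  moreover from this(2) have "int_cols m = \<alpha>" using pos by (simp add: int_cols_def vec_eq_iff \<beta>_def)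
  ultimately show "\<alpha> \<in> int_cols ` transports (\<lambda>I. I) (\<lambda>I. k * (y({} := 0)) I)" by blast
next
  fix \<alpha> assume "\<alpha> \<in> int_cols ` transports (\<lambda>I. I) (\<lambda>I. k * (y({} := 0)) I)"
  then obtain m where m: "m \<in> transports (\<lambda>I. I) (\<lambda>I. k * (y({} := 0)) I)" "\<alpha> = int_cols m" by blast
  then have supp: "\<And>I i. i \<notin> I \<Longrightarrow> m I i = 0" and row: "\<And>I. row_sum m I = k * (y({} := 0)) I"
    by (auto simp: transports_def)
  have "\<exists>s. s \<in> coord_simplex I \<and> (\<forall>i. real (m I i) = real k * real (y I) * s $ i)" if ne: "I \<noteq> {}" for I
  \<comment> \<open>Here the row vanishes and cannot be normalised; any vertex of the simplex may
    serve, since its coefficient is 0.\<close>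
  proof (cases "y I = 0")
    case True
    then have "m I i = 0" for i using row_sum_ge[of m I i] row[of I] True that by simp
    moreover obtain i where "i \<in> I" using ne by blast
    moreover from this have "axis i 1 \<in> coord_simplex I" unfolding coord_simplex_def by (simp add: hull_inc)
    ultimately show ?thesis using True by auto
  next
    case False
    define w where "w i = real (m I i) / (real k * real (y I))" for i
    have "real (\<Sum>i\<in>I. m I i) = real k * real (y I)"
    proof -
      have "(\<Sum>i\<in>I. m I i) = row_sum m I"
        unfolding row_sum_def using supp by (intro sum.mono_neutral_left) auto
      then show ?thesis using row[of I] that by simp
    qed
    then have "(\<Sum>i\<in>I. w i) = 1"
      using False assms unfolding w_def sum_divide_distrib[symmetric] by simp
    then have "(\<Sum>i\<in>I. w i *\<^sub>R axis i 1) \<in> coord_simplex I"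
      unfolding coord_simplex_def
      by (intro convex_sum) (auto simp: w_def hull_inc)
    moreover have "(\<Sum>i\<in>I. w i *\<^sub>R axis i (1::real)) $ j = w j" for j
      using supp[of j I] by (auto simp: axis_def w_def if_distrib if_distribR cong: if_cong)
    ultimately show ?thesis using False assms by (intro exI[of _ "\<Sum>i\<in>I. w i *\<^sub>R axis i 1"]) (simp add: w_def)
  qed
  then obtain s where s: "\<And>I. I \<noteq> {} \<Longrightarrow> s I \<in> coord_simplex I"
    "\<And>I i. I \<noteq> {} \<Longrightarrow> real (m I i) = real k * real (y I) * s I $ i" by metis
  have "real_vec \<alpha> = real k *\<^sub>R (\<Sum>I\<in>{I. I \<noteq> {}}. real (y I) *\<^sub>R s I)"
  proof -
    have "real (col_sum m i) = real k * (\<Sum>I\<in>{I. I \<noteq> {}}. real (y I) * s I $ i)" for i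
    proof -
      have "real (col_sum m i) = (\<Sum>I\<in>UNIV. real (m I i))" by (simp add: col_sum_def)
      also have "\<dots> = (\<Sum>I\<in>{I. I \<noteq> {}}. real (m I i))"
        using supp by (intro sum.mono_neutral_right) auto
      also have "\<dots> = real k * (\<Sum>I\<in>{I. I \<noteq> {}}. real (y I) * s I $ i)"
        unfolding sum_distrib_left by (rule sum.cong) (simp_all add: s(2) mult.assoc)
      finally show ?thesis .
    qed
    then show ?thesis using m(2) by (simp add: vec_eq_iff real_vec_def int_cols_def)
  qed
  then show "\<alpha> \<in> lattice_points (dilate (real k) (Y_polytope y))"
    using s(1) unfolding lattice_points_def dilate_def Y_polytope_eq by blast
qed

lemma lattice_points_Y_polytope: "lattice_points (Y_polytope y) = int_cols ` subset_transports y"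
  using lattice_points_dilate[of 1 y] by (simp add: dilate_def fun_upd_def)

text \<open>A Minkowski sum of convex hulls is the hull of the sum of the vertex sets, a finite set
  of integer vectors, and extreme points of a hull lie in the generating set.\<close>

lemma lattice_polytope_Y_polytope: "lattice_polytope (Y_polytope y)"
proof -
  define V where "V I = (\<lambda>i. real (y I) *\<^sub>R axis i (1::real)) ` I" for I
  have "dilate (real (y I)) (coord_simplex I) = convex hull (V I)" for I
    unfolding dilate_def coord_simplex_def V_def convex_hull_scaling[symmetric] image_image ..
  then have P: "Y_polytope y = convex hull (\<Sum>I\<in>{I. I \<noteq> {}}. V I)"
    by (simp add: Y_polytope_def convex_hull_set_sum)
  have finite_sum: "finite (\<Sum>I\<in>F. V I)" if "finite F" for F
    using that by (induction F) (auto simp: V_def finite_set_plus)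
  have "(\<Sum>I\<in>{I. I \<noteq> {}}. V I) \<subseteq> range real_vec"
  proof
    fix v assume "v \<in> (\<Sum>I\<in>{I. I \<noteq> {}}. V I)"
    then obtain x where x: "v = sum x {I. I \<noteq> {}}" "\<And>I. I \<noteq> {} \<Longrightarrow> x I \<in> V I"
      by (subst (asm) set_sum_alt) auto
    have "\<exists>a. x I = real_vec a" if ne: "I \<noteq> {}" for I
    proof -
      obtain i where "x I = real (y I) *\<^sub>R axis i 1" using x(2)[OF ne] by (auto simp: V_def)
      then have "x I = real_vec (axis i (int (y I)))"
        by (simp add: real_vec_def axis_def vec_eq_iff)
      then show ?thesis by blast
    qed
    then obtain a where a: "\<And>I. I \<noteq> {} \<Longrightarrow> x I = real_vec (a I)" by metis
    have "v = real_vec (sum a {I. I \<noteq> {}})"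
      unfolding x(1) by (simp add: a real_vec_def vec_eq_iff)
    then show "v \<in> range real_vec" by blast
  qed
  then show ?thesis
    unfolding lattice_polytope_def P
    using polytope_convex_hull[OF finite_sum[OF finite]] extreme_point_of_convex_hull by blast
qed

lemma IDP_Y_polytope: "IDP (Y_polytope y)"
  unfolding IDP_def
proof (intro conjI allI impI ballI)
  show "lattice_polytope (Y_polytope y)" by (rule lattice_polytope_Y_polytope)
  fix k :: nat and \<alpha>
  assume "0 < k" "\<alpha> \<in> lattice_points (dilate (real k) (Y_polytope y))"
  then obtain m where m: "m \<in> transports (\<lambda>I. I) (\<lambda>I. k * (y({} := 0)) I)" "\<alpha> = int_cols m"
    unfolding lattice_points_dilate[OF \<open>0 < k\<close>] by blast
  obtain ms where ms: "size ms = k" "set_mset ms \<subseteq> subset_transports y" "total ms = m"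
    using transports_decompose[OF m(1)] by blast
  obtain xs where xs: "mset xs = ms" using ex_mset by blast
  have len: "length xs = k" using ms(1) xs size_mset by metis
  let ?a = "\<lambda>j. int_cols (xs ! (j - 1))"
  have "(\<Sum>j=1..k. ?a j) = (\<Sum>j<k. int_cols (xs ! j))"
    by (rule sum.reindex_bij_witness[of _ Suc "\<lambda>j. j - 1"]) auto
  also have "\<dots> = sum_list (map int_cols xs)"
    by (simp add: sum_list_sum_nth atLeast0LessThan len)
  also have "\<dots> = \<alpha>"
    unfolding m(2) ms(3)[symmetric] int_cols_total xs[symmetric] by (metis mset_map sum_mset_sum_list)
  finally have "\<alpha> = (\<Sum>j=1..k. ?a j)" ..
  moreover have "?a j \<in> lattice_points (Y_polytope y)" if "j \<in> {1..k}" for j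
  proof -
    have "xs ! (j - 1) \<in> set xs" using that len by (intro nth_mem) auto
    then have "xs ! (j - 1) \<in># ms" using xs set_mset_mset by metis
    then show ?thesis using ms(2) unfolding lattice_points_Y_polytope by blast
  qed
  ultimately show "\<exists>a. (\<forall>j\<in>{1..k}. a j \<in> lattice_points (Y_polytope y)) \<and> \<alpha> = (\<Sum>j=1..k. a j)"
    by (intro exI[of _ ?a]) blast
qed

section \<open>Ideals generated by differences of monomials\<close>

lemma polys_closed:
  fixes f g :: "('v \<Rightarrow>\<^sub>0 nat) \<Rightarrow>\<^sub>0 'k::field"
  shows "0 \<in> polys V" "1 \<in> polys V"
    and "f \<in> polys V \<Longrightarrow> g \<in> polys V \<Longrightarrow> f + g \<in> polys V"
    and "f \<in> polys V \<Longrightarrow> g \<in> polys V \<Longrightarrow> f - g \<in> polys V"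
    and "f \<in> polys V \<Longrightarrow> g \<in> polys V \<Longrightarrow> f * g \<in> polys V"
    and "u \<in> monomials V \<Longrightarrow> Poly_Mapping.single u c \<in> polys V"
proof -
  show "0 \<in> polys V" "1 \<in> polys V" "u \<in> monomials V \<Longrightarrow> Poly_Mapping.single u c \<in> polys V"
    by (auto simp: polys_def monomials_def)
  assume f: "f \<in> polys V" and g: "g \<in> polys V"
  show "f + g \<in> polys V" using f g Poly_Mapping.keys_add[of f g] by (auto simp: polys_def)
  show "f - g \<in> polys V" using f g keys_diff[of f g] by (auto simp: polys_def)
  show "f * g \<in> polys V"
    unfolding polys_def mem_Collect_eq
  proof
    fix u assume "u \<in> Poly_Mapping.keys (f * g)"
    then obtain a b where "u = a + b" "a \<in> Poly_Mapping.keys f" "b \<in> Poly_Mapping.keys g"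
      using Poly_Mapping.keys_mult[of f g] by blast
    then show "u \<in> monomials V"
      using f g Poly_Mapping.keys_add[of a b] unfolding polys_def monomials_def by blast
  qed
qed

lemma monomials_add: "u \<in> monomials V \<Longrightarrow> v \<in> monomials V \<Longrightarrow> u + v \<in> monomials V"
  using Poly_Mapping.keys_add[of u v] by (auto simp: monomials_def)

lemma poly_eq_sum_single:
  "f = (\<Sum>u\<in>Poly_Mapping.keys f. Poly_Mapping.single u (Poly_Mapping.lookup f u))"
  by (rule poly_mapping_eqI) (simp add: lookup_sum lookup_single when_def in_keys_iff)

lemma ideal_generated_base: "g \<in> G \<Longrightarrow> g \<in> ideal_generated V G"
  unfolding ideal_generated_def
  by (intro CollectI exI[of _ "{g}"] exI[of _ "\<lambda>_. 1"]) (simp add: polys_closed)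

lemma ideal_generated_zero: "0 \<in> ideal_generated V G"
  unfolding ideal_generated_def by (intro CollectI exI[of _ "{}"]) simp

lemma ideal_generated_add:
  fixes a b :: "('v \<Rightarrow>\<^sub>0 nat) \<Rightarrow>\<^sub>0 'k::field"
  assumes "a \<in> ideal_generated V G" "b \<in> ideal_generated V G"
  shows "a + b \<in> ideal_generated V G"
proof -
  obtain F h where F: "finite F" "F \<subseteq> G" "\<forall>g\<in>F. h g \<in> polys V" "a = (\<Sum>g\<in>F. h g * g)"
    using assms(1) unfolding ideal_generated_def by blast
  obtain F' h' where F': "finite F'" "F' \<subseteq> G" "\<forall>g\<in>F'. h' g \<in> polys V" "b = (\<Sum>g\<in>F'. h' g * g)"
    using assms(2) unfolding ideal_generated_def by blast
  define e where "e g = (if g \<in> F then h g else 0)" for g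
  define e' where "e' g = (if g \<in> F' then h' g else 0)" for g
  have "a = (\<Sum>g\<in>F \<union> F'. e g * g)"
    unfolding F(4) using F(1) F'(1) by (intro sum.mono_neutral_cong_left) (auto simp: e_def)
  moreover have "b = (\<Sum>g\<in>F \<union> F'. e' g * g)"
    unfolding F'(4) using F(1) F'(1) by (intro sum.mono_neutral_cong_left) (auto simp: e'_def)
  ultimately have "a + b = (\<Sum>g\<in>F \<union> F'. (e g + e' g) * g)"
    by (simp add: sum.distrib distrib_right)
  moreover have "\<forall>g\<in>F \<union> F'. e g + e' g \<in> polys V"
    using F(3) F'(3) by (auto simp: e_def e'_def intro!: polys_closed)
  ultimately show ?thesis
    unfolding ideal_generated_def using F(1,2) F'(1,2)
    by (intro CollectI exI[of _ "F \<union> F'"] exI[of _ "\<lambda>g. e g + e' g"]) simp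
qed

lemma ideal_generated_mult:
  assumes "a \<in> ideal_generated V G" "p \<in> polys V"
  shows "p * a \<in> ideal_generated V G"
proof -
  obtain F h where F: "finite F" "F \<subseteq> G" "\<forall>g\<in>F. h g \<in> polys V" "a = (\<Sum>g\<in>F. h g * g)"
    using assms(1) unfolding ideal_generated_def by blast
  then show ?thesis
    unfolding ideal_generated_def using assms(2)
    by (intro CollectI exI[of _ F] exI[of _ "\<lambda>g. p * h g"])
      (auto simp: sum_distrib_left mult.assoc intro: polys_closed)
qed

lemma ideal_generated_sum:
  "(\<And>x. x \<in> X \<Longrightarrow> f x \<in> ideal_generated V G) \<Longrightarrow> sum f X \<in> ideal_generated V G"
  by (induction X rule: infinite_finite_induct) (auto simp: ideal_generated_zero ideal_generated_add)

lemma ideal_generated_subset: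
  assumes "G \<subseteq> ideal_generated V H"
  shows "ideal_generated V G \<subseteq> ideal_generated V H"
proof
  fix a assume "a \<in> ideal_generated V G"
  then obtain F h where F: "F \<subseteq> G" "\<forall>g\<in>F. h g \<in> polys V" "a = (\<Sum>g\<in>F. h g * g)"
    unfolding ideal_generated_def by blast
  then show "a \<in> ideal_generated V H"
    using assms by (auto intro!: ideal_generated_sum ideal_generated_mult)
qed

lemma ideal_generated_monomial_multiple:
  assumes "monom_poly w \<in> G" "w' \<in> monomials V"
  shows "monom_poly (w' + w) \<in> ideal_generated V G"
  using ideal_generated_mult[OF ideal_generated_base[OF assms(1)] polys_closed(6)[OF assms(2), of 1]]
  by (simp add: mult_single)

text \<open>The coefficient at \<open>e\<close> of the image of \<open>f\<close> under the linear
  map sending the monomial \<open>u\<close> to the basis element \<open>d u\<close>. With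
  \<open>d = exponent_vector\<close>, \<open>fibre_kernel\<close> is the toric ideal.\<close>

definition fibre_sum :: "(('v \<Rightarrow>\<^sub>0 nat) \<Rightarrow> 'd) \<Rightarrow> 'd \<Rightarrow> (('v \<Rightarrow>\<^sub>0 nat) \<Rightarrow>\<^sub>0 'k::field) \<Rightarrow> 'k" where
  "fibre_sum d e f = (\<Sum>u\<in>Poly_Mapping.keys f. if d u = e then Poly_Mapping.lookup f u else 0)"

definition fibre_kernel :: "'v set \<Rightarrow> (('v \<Rightarrow>\<^sub>0 nat) \<Rightarrow> 'd) \<Rightarrow> (('v \<Rightarrow>\<^sub>0 nat) \<Rightarrow>\<^sub>0 'k::field) set" where
  "fibre_kernel V d = {f \<in> polys V. \<forall>e. fibre_sum d e f = 0}"

lemma fibre_sum_add: "fibre_sum d e (f + g) = fibre_sum d e f + fibre_sum d e g"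
  unfolding fibre_sum_def
  by (rule setsum_keys_plus_distrib[where f = "\<lambda>u c. if d u = e then c else 0"]) auto

lemma fibre_sum_single: "fibre_sum d e (Poly_Mapping.single u c) = (if d u = e then c else 0)"
  by (simp add: fibre_sum_def)

lemma fibre_sum_diff: "fibre_sum d e (f - g) = fibre_sum d e f - fibre_sum d e g"
  using fibre_sum_add[of d e "f - g" g] by simp

lemma fibre_sum_zero: "fibre_sum d e 0 = 0"
  by (simp add: fibre_sum_def)

lemma fibre_kernel_sum:
  "(\<And>x. x \<in> X \<Longrightarrow> f x \<in> fibre_kernel V d) \<Longrightarrow> sum f X \<in> fibre_kernel V d"
  by (induction X rule: infinite_finite_induct)
    (auto simp: fibre_sum_zero fibre_kernel_def fibre_sum_add intro: polys_closed)

lemma fibre_kernel_binomial: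
  "u \<in> monomials V \<Longrightarrow> v \<in> monomials V \<Longrightarrow> d u = d v \<Longrightarrow>
    Poly_Mapping.single u c - Poly_Mapping.single v c \<in> fibre_kernel V d"
  by (auto simp: fibre_kernel_def fibre_sum_diff fibre_sum_single intro!: polys_closed)

text \<open>Choose one monomial of \<open>f\<close> in each fibre and subtract it from the others:
  the coefficients in a fibre sum to 0, so \<open>f\<close> becomes a combination of binomials
  within fibres. Conversely, by \<open>d_add\<close> monomial multiples of generators stay within
  fibres.\<close>

lemma fibre_kernel_eq_ideal_generated:
  fixes d :: "('v \<Rightarrow>\<^sub>0 nat) \<Rightarrow> 'd" and G :: "(('v \<Rightarrow>\<^sub>0 nat) \<Rightarrow>\<^sub>0 'k::field) set"
  assumes d_add: "\<And>u v w. d u = d v \<Longrightarrow> d (w + u) = d (w + v)"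
    and G: "\<And>g. g \<in> G \<Longrightarrow> \<exists>u\<in>monomials V. \<exists>v\<in>monomials V. d u = d v \<and> g = monom_poly u - monom_poly v"
    and generates: "\<And>u v. u \<in> monomials V \<Longrightarrow> v \<in> monomials V \<Longrightarrow> d u = d v \<Longrightarrow>
      monom_poly u - monom_poly v \<in> ideal_generated V G"
  shows "fibre_kernel V d = ideal_generated V G"
proof (intro equalityI subsetI)
  fix f :: "('v \<Rightarrow>\<^sub>0 nat) \<Rightarrow>\<^sub>0 'k" assume f: "f \<in> fibre_kernel V d"
  define K where "K = Poly_Mapping.keys f"
  define rep where "rep e = (SOME u. u \<in> K \<and> d u = e)" for e
  have rep: "rep (d u) \<in> K \<and> d (rep (d u)) = d u" if "u \<in> K" for u
    unfolding rep_def by (rule someI[of _ u]) (use that in simp)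
  have K: "K \<subseteq> monomials V" using f by (simp add: K_def fibre_kernel_def polys_def)
  let ?s = "\<lambda>u v. Poly_Mapping.single v (Poly_Mapping.lookup f u)"
  have "(\<Sum>u\<in>K. ?s u (rep (d u))) = 0"
  proof (rule poly_mapping_eqI)
    fix w
    have "Poly_Mapping.lookup (\<Sum>u\<in>K. ?s u (rep (d u))) w =
        (\<Sum>u\<in>K. if rep (d u) = w then Poly_Mapping.lookup f u else 0)"
      by (simp add: lookup_sum lookup_single when_def)
    \<comment> \<open>\<open>rep (d u) = w\<close> means that \<open>w\<close> represents its own
      fibre and \<open>u\<close> lies in that fibre. The coefficient at such a \<open>w\<close> is a
      full fibre sum of \<open>f\<close>.\<close>
    also have "\<dots> = (\<Sum>u\<in>K. if w \<in> K \<and> rep (d w) = w \<and> d u = d w then Poly_Mapping.lookup f u else 0)"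
      using rep by (intro sum.cong refl if_cong) metis+
    also have "\<dots> = 0"
    proof (cases "w \<in> K \<and> rep (d w) = w")
      case True
      then show ?thesis using f by (simp add: fibre_kernel_def fibre_sum_def K_def)
    next
      case False
      then show ?thesis by (intro sum.neutral) auto
    qed
    finally show "Poly_Mapping.lookup (\<Sum>u\<in>K. ?s u (rep (d u))) w = Poly_Mapping.lookup 0 w" by simp
  qed
  then have "f = (\<Sum>u\<in>K. ?s u u - ?s u (rep (d u)))"
    using poly_eq_sum_single[of f] by (simp add: sum_subtractf K_def)
  also have "\<dots> = (\<Sum>u\<in>K. Poly_Mapping.single 0 (Poly_Mapping.lookup f u) * (monom_poly u - monom_poly (rep (d u))))"
    by (simp add: right_diff_distrib mult_single)
  also have "\<dots> \<in> ideal_generated V G"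
    using K rep by (intro ideal_generated_sum ideal_generated_mult generates polys_closed)
      (auto simp: monomials_def)
  finally show "f \<in> ideal_generated V G" .
next
  fix f assume "f \<in> ideal_generated V G"
  then obtain F h where F: "F \<subseteq> G" "\<forall>g\<in>F. h g \<in> polys V" "f = (\<Sum>g\<in>F. h g * g)"
    unfolding ideal_generated_def by blast
  have "h g * g \<in> fibre_kernel V d" if gF: "g \<in> F" for g
  proof -
    obtain u v where uv: "u \<in> monomials V" "v \<in> monomials V" "d u = d v" "g = monom_poly u - monom_poly v"
      using G[of g] F(1) gF by blast
    have "h g * g = (\<Sum>w\<in>Poly_Mapping.keys (h g). Poly_Mapping.single w (Poly_Mapping.lookup (h g) w)) * g"
      by (simp flip: poly_eq_sum_single)
    also have "\<dots> = (\<Sum>w\<in>Poly_Mapping.keys (h g). Poly_Mapping.single (w + u) (Poly_Mapping.lookup (h g) w)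
        - Poly_Mapping.single (w + v) (Poly_Mapping.lookup (h g) w))"
      by (simp add: uv(4) sum_distrib_right right_diff_distrib mult_single sum_subtractf)
    also have "\<dots> \<in> fibre_kernel V d"
      using F(2) gF uv by (intro fibre_kernel_sum fibre_kernel_binomial monomials_add d_add)
        (auto simp: polys_def)
    finally show ?thesis .
  qed
  then show "f \<in> fibre_kernel V d" unfolding F(3) by (rule fibre_kernel_sum)
qed

section \<open>Initial monomials and squarefree initial ideals\<close>

lemma initial_monomial_eqI:
  assumes "monomial_order V r" "f \<in> polys V" "u \<in> Poly_Mapping.keys f"
    "\<And>v. v \<in> Poly_Mapping.keys f \<Longrightarrow> (v, u) \<in> r"
  shows "initial_monomial r f = u"
  unfolding initial_monomial_def
proof (rule the_equality)
  have "antisym r"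
    using assms(1) by (auto simp: monomial_order_def linear_order_on_def partial_order_on_def)
  moreover fix w assume "w \<in> Poly_Mapping.keys f \<and> (\<forall>v\<in>Poly_Mapping.keys f. (v, w) \<in> r)"
  ultimately show "w = u"
    using assms(3,4) by (auto dest: antisymD)
qed (use assms in blast)

lemma initial_monomial_exists:
  assumes "monomial_order V r" "f \<in> polys V" "f \<noteq> 0"
  shows "\<exists>u\<in>Poly_Mapping.keys f. \<forall>v\<in>Poly_Mapping.keys f. (v, u) \<in> r"
proof -
  have lin: "linear_order_on (monomials V) r" using assms(1) by (simp add: monomial_order_def)
  have "\<exists>u\<in>X. \<forall>v\<in>X. (v, u) \<in> r" if "finite X" "X \<noteq> {}" "X \<subseteq> monomials V" for X
    using that
  proof (induction rule: finite_ne_induct)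
    case (singleton x)
    then show ?case
      using lin by (auto simp: linear_order_on_def partial_order_on_def preorder_on_def refl_on_def)
  next
    case (insert x X)
    then obtain u where u: "u \<in> X" "\<forall>v\<in>X. (v, u) \<in> r" by auto
    have refl: "(x, x) \<in> r"
      using lin insert.prems
      by (auto simp: linear_order_on_def partial_order_on_def preorder_on_def refl_on_def)
    show ?case
    proof (cases "(x, u) \<in> r")
      case True
      then show ?thesis using u by blast
    next
      case False
      then have xu: "(u, x) \<in> r"
        using lin u(1) insert.prems refl by (auto simp: linear_order_on_def total_on_def)
      have "trans r"
        using lin by (auto simp: linear_order_on_def partial_order_on_def preorder_on_def)
      then have "(v, x) \<in> r" if "v \<in> X" for v
        using that u xu by (blast dest: transD)
      then show ?thesis using refl by blast
    qed
  qed
  from this[of "Poly_Mapping.keys f"] show ?thesis using assms(2,3) by (simp add: polys_def)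
qed

text \<open>The initial monomial of \<open>f\<close> cannot be alone in its fibre among the
  monomials of \<open>f\<close>, or its coefficient would be a vanishing fibre sum; so it exceeds
  another one and the hypothesis supplies a squarefree divisor. Conversely, each such divisor
  \<open>w\<close> is the initial monomial of the binomial formed with its smaller companion
  \<open>x\<close>.\<close>

lemma squarefree_initial_ideal_fibre_kernel:
  fixes d :: "('v \<Rightarrow>\<^sub>0 nat) \<Rightarrow> 'd"
  assumes r: "monomial_order V r"
    and squarefree: "\<And>u v. u \<in> monomials V \<Longrightarrow> v \<in> monomials V \<Longrightarrow> d u = d v \<Longrightarrow> u \<noteq> v \<Longrightarrow> (v, u) \<in> r \<Longrightarrow>
      \<exists>w\<in>monomials V. \<exists>w'\<in>monomials V. squarefree_monomial w \<and> u = w' + w \<and>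
        (\<exists>x\<in>monomials V. d x = d w \<and> x \<noteq> w \<and> (x, w) \<in> r)"
  shows "has_squarefree_initial_ideal V (fibre_kernel V d :: (('v \<Rightarrow>\<^sub>0 nat) \<Rightarrow>\<^sub>0 'k::field) set)"
proof -
  define S where "S = {w \<in> monomials V. squarefree_monomial w \<and> (\<exists>x\<in>monomials V. d x = d w \<and> x \<noteq> w \<and> (x, w) \<in> r)}"
  define J where "J = (fibre_kernel V d :: (('v \<Rightarrow>\<^sub>0 nat) \<Rightarrow>\<^sub>0 'k) set)"
  have "initial_ideal V r J \<subseteq> ideal_generated V (monom_poly ` S)"
    unfolding initial_ideal_def
  proof (intro ideal_generated_subset subsetI)
    fix p assume "p \<in> {monom_poly (initial_monomial r f) :: _ \<Rightarrow>\<^sub>0 'k | f. f \<in> J \<and> f \<noteq> 0}"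
    then obtain f where f: "f \<in> J" "f \<noteq> 0" "p = monom_poly (initial_monomial r f)" by blast
    have fV: "f \<in> polys V" using f(1) by (simp add: J_def fibre_kernel_def)
    then obtain u where u: "u \<in> Poly_Mapping.keys f" "\<forall>v\<in>Poly_Mapping.keys f. (v, u) \<in> r"
      using initial_monomial_exists[OF r _ f(2)] by blast
    then have p: "p = monom_poly u" using initial_monomial_eqI[OF r fV] f(3) by simp
    have "\<exists>v\<in>Poly_Mapping.keys f. d v = d u \<and> v \<noteq> u"
    proof (rule ccontr)
      assume "\<not> (\<exists>v\<in>Poly_Mapping.keys f. d v = d u \<and> v \<noteq> u)"
      then have "fibre_sum d (d u) f = (\<Sum>v\<in>Poly_Mapping.keys f. if v = u then Poly_Mapping.lookup f v else 0)"
        unfolding fibre_sum_def by (intro sum.cong) auto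
      then have "Poly_Mapping.lookup f u = 0"
        using f(1) u(1) by (simp add: J_def fibre_kernel_def)
      then show False using u(1) by (simp add: in_keys_iff)
    qed
    then obtain v where "v \<in> Poly_Mapping.keys f" "d u = d v" "u \<noteq> v" by metis
    then obtain w w' where "w \<in> S" "w' \<in> monomials V" "u = w' + w"
      using squarefree[of u v] u fV unfolding S_def polys_def by blast
    then show "p \<in> ideal_generated V (monom_poly ` S)"
      unfolding p by (auto intro: ideal_generated_monomial_multiple)
  qed
  moreover have "ideal_generated V (monom_poly ` S) \<subseteq> initial_ideal V r J"
    unfolding initial_ideal_def
  proof (intro ideal_generated_subset subsetI)
    fix p assume "p \<in> (monom_poly ` S :: (_ \<Rightarrow>\<^sub>0 'k) set)"
    then obtain w x where w: "p = monom_poly w" "w \<in> monomials V" "x \<in> monomials V" "d x = d w" "x \<noteq> w" "(x, w) \<in> r"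
      unfolding S_def by blast
    let ?f = "monom_poly w - monom_poly x :: ('v \<Rightarrow>\<^sub>0 nat) \<Rightarrow>\<^sub>0 'k"
    have f: "?f \<in> J" unfolding J_def using w by (intro fibre_kernel_binomial) auto
    have lookup: "Poly_Mapping.lookup ?f z = (if z = w then 1 else if z = x then -1 else 0)" for z
      using w(5) by (auto simp: lookup_minus lookup_single when_def)
    have keys: "Poly_Mapping.keys ?f = {w, x}"
      by (auto simp: in_keys_iff lookup split: if_splits)
    have "(w, w) \<in> r"
      using r w(2) by (auto simp: monomial_order_def linear_order_on_def partial_order_on_def
          preorder_on_def refl_on_def)
    then have "initial_monomial r ?f = w"
      using f w(6) by (intro initial_monomial_eqI[OF r]) (auto simp: J_def fibre_kernel_def keys)
    moreover have "?f \<noteq> 0" using lookup[of w] by auto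
    ultimately show "p \<in> ideal_generated V {monom_poly (initial_monomial r f) | f. f \<in> J \<and> f \<noteq> 0}"
      using f w(1) by (intro ideal_generated_base) force
  qed
  ultimately have "initial_ideal V r J = ideal_generated V (monom_poly ` S)" by blast
  moreover have "S \<subseteq> monomials V" "\<forall>u\<in>S. squarefree_monomial u" by (auto simp: S_def)
  ultimately show ?thesis
    unfolding has_squarefree_initial_ideal_def J_def[symmetric] using r by blast
qed

section \<open>Monomials as multisets\<close>

definition mset_of :: "('v \<Rightarrow>\<^sub>0 nat) \<Rightarrow> 'v multiset" where
  "mset_of u = Abs_multiset (Poly_Mapping.lookup u)"

definition monomial_of :: "'v multiset \<Rightarrow> ('v \<Rightarrow>\<^sub>0 nat)" where
  "monomial_of A = (\<Sum>v\<in>#A. Poly_Mapping.single v 1)"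

lemma count_mset_of [simp]: "count (mset_of u) v = Poly_Mapping.lookup u v"
proof -
  have "finite {v. 0 < Poly_Mapping.lookup u v}"
    using finite_lookup[of u] by simp
  then show ?thesis by (simp add: mset_of_def)
qed

lemma mset_of_add [simp]: "mset_of (u + v) = mset_of u + mset_of v"
  by (rule multiset_eqI) (simp add: lookup_add)

lemma mset_of_0 [simp]: "mset_of 0 = {#}"
  by (rule multiset_eqI) simp

lemma set_mset_of [simp]: "set_mset (mset_of u) = Poly_Mapping.keys u"
  by (auto simp: set_mset_def in_keys_iff)

lemma lookup_monomial_of [simp]: "Poly_Mapping.lookup (monomial_of A) v = count A v"
  by (induction A) (auto simp: monomial_of_def lookup_add lookup_single when_def)

lemma mset_of_monomial_of [simp]: "mset_of (monomial_of A) = A"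
  by (rule multiset_eqI) simp

lemma monomial_of_mset_of [simp]: "monomial_of (mset_of u) = u"
  by (rule poly_mapping_eqI) simp

lemma monomial_of_add: "monomial_of (A + B) = monomial_of A + monomial_of B"
  by (simp add: monomial_of_def)

lemma monomial_of_in_monomials [simp]: "monomial_of A \<in> monomials V \<longleftrightarrow> set_mset A \<subseteq> V"
  by (metis mem_Collect_eq monomials_def mset_of_monomial_of set_mset_of)

lemma monomial_degree_eq: "monomial_degree u = size (mset_of u)"
  by (simp add: monomial_degree_def size_multiset_overloaded_eq)

definition exponent_vector :: "(int ^ 'n \<Rightarrow>\<^sub>0 nat) \<Rightarrow> (int ^ 'n) \<times> int" where
  "exponent_vector u = (\<Sum>\<alpha>\<in>#mset_of u. (\<alpha>, 1))"

lemma exponent_vector_eq: "exponent_vector u = (\<Sum>\<^sub># (mset_of u), int (size (mset_of u)))"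
proof -
  have "(\<Sum>\<alpha>\<in>#A. (\<alpha>, 1)) = (\<Sum>\<^sub># A, int (size A))" for A :: "(int ^ 'n) multiset"
    by (induction A) (simp_all add: zero_prod_def)
  then show ?thesis by (simp add: exponent_vector_def)
qed

lemma toric_hom_eq:
  fixes f :: "(int ^ 'n \<Rightarrow>\<^sub>0 nat) \<Rightarrow>\<^sub>0 'k::field"
  shows "toric_hom f =
    (\<Sum>u\<in>Poly_Mapping.keys f. Poly_Mapping.single (exponent_vector u) (Poly_Mapping.lookup f u))"
proof -
  let ?t = "\<lambda>\<alpha>. Poly_Mapping.single (\<alpha>, 1) 1 :: ((int ^ 'n) \<times> int) \<Rightarrow>\<^sub>0 'k"
  have monomial: "(\<Prod>\<alpha>\<in>#A. ?t \<alpha>) = Poly_Mapping.single (\<Sum>\<alpha>\<in>#A. (\<alpha>, 1)) 1" for A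
    by (induction A) (simp_all add: mult_single)
  have "(\<Prod>\<alpha>\<in>Poly_Mapping.keys u. ?t \<alpha> ^ Poly_Mapping.lookup u \<alpha>)
      = Poly_Mapping.single (exponent_vector u) 1" for u
    unfolding exponent_vector_def monomial[symmetric]
    by (simp add: image_prod_mset_multiplicity)
  then show ?thesis by (simp add: toric_hom_def mult_single)
qed

lemma toric_ideal_eq:
  "(toric_ideal P :: ((int ^ 'n \<Rightarrow>\<^sub>0 nat) \<Rightarrow>\<^sub>0 'k::field) set) = fibre_kernel (lattice_points P) exponent_vector"
proof -
  have *: "Poly_Mapping.lookup (toric_hom f) e = fibre_sum exponent_vector e f"
    for f :: "(int ^ 'n \<Rightarrow>\<^sub>0 nat) \<Rightarrow>\<^sub>0 'k" and e
    by (simp add: toric_hom_eq lookup_sum lookup_single when_def fibre_sum_def)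
  have "toric_hom f = 0 \<longleftrightarrow> (\<forall>e. fibre_sum exponent_vector e f = 0)"
    for f :: "(int ^ 'n \<Rightarrow>\<^sub>0 nat) \<Rightarrow>\<^sub>0 'k"
    unfolding poly_mapping_eq_iff fun_eq_iff * by simp
  then show ?thesis by (simp add: toric_ideal_def fibre_kernel_def)
qed

section \<open>Quadratic generation\<close>

definition cols_monomial :: "('n::finite set \<Rightarrow> 'n \<Rightarrow> nat) multiset \<Rightarrow> (int ^ 'n \<Rightarrow>\<^sub>0 nat)" where
  "cols_monomial ms = monomial_of (image_mset int_cols ms)"

lemma cols_monomial_add: "cols_monomial (A + B) = cols_monomial A + cols_monomial B"
  by (simp add: cols_monomial_def monomial_of_add)

lemma cols_monomial_in_monomials:
  "set_mset ms \<subseteq> T \<Longrightarrow> cols_monomial ms \<in> monomials (int_cols ` T)"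
  by (auto simp: cols_monomial_def)

lemma exponent_vector_cols_monomial:
  "exponent_vector (cols_monomial ms) = (int_cols (total ms), int (size ms))"
  by (simp add: exponent_vector_eq cols_monomial_def int_cols_total)

lemma obtain_matrices:
  assumes "u \<in> monomials (int_cols ` T)"
  obtains ms where "set_mset ms \<subseteq> T" "u = cols_monomial ms"
proof -
  have keys: "Poly_Mapping.keys u \<subseteq> int_cols ` T" using assms by (simp add: monomials_def)
  define g where "g = inv_into T int_cols"
  have g: "g \<alpha> \<in> T" "int_cols (g \<alpha>) = \<alpha>" if "\<alpha> \<in> Poly_Mapping.keys u" for \<alpha>
    using that keys inv_into_into[of \<alpha> int_cols T] f_inv_into_f[of \<alpha> int_cols T] by (auto simp: g_def)
  show ?thesis
  proof (rule that[of "image_mset g (mset_of u)"])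
    show "set_mset (image_mset g (mset_of u)) \<subseteq> T" using g(1) by auto
    have "image_mset (\<lambda>\<alpha>. int_cols (g \<alpha>)) (mset_of u) = image_mset (\<lambda>\<alpha>. \<alpha>) (mset_of u)"
      by (rule image_mset_cong) (simp add: g(2))
    then show "u = cols_monomial (image_mset g (mset_of u))"
      by (simp add: cols_monomial_def image_mset.compositionality comp_def)
  qed
qed

text \<open>All quadratic binomials of the toric ideal are taken, so generation means joining any
  two monomials of a fibre by moves of degree 2.\<close>

definition toric_quadrics :: "(int ^ 'n) set \<Rightarrow> ((int ^ 'n \<Rightarrow>\<^sub>0 nat) \<Rightarrow>\<^sub>0 'k::field) set" where
  "toric_quadrics V = {monom_poly u - monom_poly v | u v. u \<in> monomials V \<and> v \<in> monomials V \<and> u \<noteq> v \<and>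
     monomial_degree u = 2 \<and> monomial_degree v = 2 \<and> exponent_vector u = exponent_vector v}"

context
  fixes y :: "'n::finite set \<Rightarrow> nat" and T :: "('n set \<Rightarrow> 'n \<Rightarrow> nat) set"
    and V :: "(int ^ 'n) set"
    and I :: "((int ^ 'n \<Rightarrow>\<^sub>0 nat) \<Rightarrow>\<^sub>0 'k::field) set"
  defines "T \<equiv> subset_transports y" and "V \<equiv> int_cols ` T"
    and "I \<equiv> ideal_generated V (toric_quadrics V)"
begin

private lemma zero_in_I: "0 \<in> I"
  by (simp add: I_def ideal_generated_zero)

private lemma congruent_sym:
  assumes "monom_poly u - monom_poly v \<in> I"
  shows "monom_poly v - monom_poly u \<in> I"
proof -
  have "(0 - 1) * (monom_poly u - monom_poly v) \<in> I"
    using assms unfolding I_def by (intro ideal_generated_mult polys_closed)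
  then show ?thesis by simp
qed

private lemma congruent_trans:
  "monom_poly u - monom_poly v \<in> I \<Longrightarrow> monom_poly v - monom_poly w \<in> I \<Longrightarrow> monom_poly u - monom_poly w \<in> I"
  using ideal_generated_add[of "monom_poly u - monom_poly v" V "toric_quadrics V" "monom_poly v - monom_poly w"]
  unfolding I_def by simp

private lemma congruent_mult:
  assumes "monom_poly u - monom_poly v \<in> I" "w \<in> monomials V"
  shows "monom_poly (w + u) - monom_poly (w + v) \<in> I"
proof -
  have "monom_poly w * (monom_poly u - monom_poly v) \<in> I"
    using assms unfolding I_def by (intro ideal_generated_mult polys_closed)
  then show ?thesis by (simp add: right_diff_distrib mult_single)
qed

private lemma congruent_pair:
  assumes "{a, b, c, d} \<subseteq> T" "\<And>I i. c I i + d I i = a I i + b I i"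
  shows "monom_poly (cols_monomial {#a, b#}) - monom_poly (cols_monomial {#c, d#}) \<in> I"
proof (cases "cols_monomial {#a, b#} = cols_monomial {#c, d#}")
  case True
  then show ?thesis by (simp add: zero_in_I)
next
  case False
  have "total {#a, b#} = total {#c, d#}" using assms(2) by (simp add: fun_eq_iff)
  then have "exponent_vector (cols_monomial {#a, b#}) = exponent_vector (cols_monomial {#c, d#})"
    by (simp only: exponent_vector_cols_monomial) simp
  moreover have "monomial_degree (cols_monomial {#a, b#}) = 2" "monomial_degree (cols_monomial {#c, d#}) = 2"
    by (simp_all add: monomial_degree_eq cols_monomial_def)
  moreover have "cols_monomial {#a, b#} \<in> monomials V" "cols_monomial {#c, d#} \<in> monomials V"
    using assms(1) by (auto simp: V_def intro: cols_monomial_in_monomials)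
  ultimately show ?thesis
    unfolding I_def using False by (intro ideal_generated_base) (auto simp: toric_quadrics_def)
qed

text \<open>The balanced decomposition is a normal form: \<open>balancing\<close> leads both sides
  to it by quadratic moves, and \<open>balanced_unique\<close> identifies the results.\<close>

private lemma congruent_same_total:
  assumes "set_mset A \<subseteq> T" "set_mset B \<subseteq> T" "size A = size B" "total A = total B"
  shows "monom_poly (cols_monomial A) - monom_poly (cols_monomial B) \<in> I"
proof -
  define R where "R A B \<longleftrightarrow> monom_poly (cols_monomial A) - monom_poly (cols_monomial B) \<in> I" for A B
  have "reflp R" by (auto simp: R_def reflp_def zero_in_I)
  moreover have "transp R" unfolding R_def transp_def using congruent_trans by blast
  moreover have "R (A + {#a, b#}) (A + {#c, d#})"
    if "{a, b, c, d} \<subseteq> T" "set_mset A \<subseteq> T" "\<And>I i. c I i + d I i = a I i + b I i" for A a b c d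
    unfolding R_def cols_monomial_add
    using that by (intro congruent_mult congruent_pair) (auto simp: V_def intro: cols_monomial_in_monomials)
  ultimately have "\<exists>B. R A B \<and> set_mset B \<subseteq> T \<and> size B = size A \<and> total B = total A \<and> balanced (set_mset B)"
    if "set_mset A \<subseteq> T" for A
    using that balancing[of R "\<lambda>I. I" "y({} := 0)" A] unfolding T_def by blast
  then obtain A' B' where
    A': "R A A'" "size A' = size A" "total A' = total A" "balanced (set_mset A')" and
    B': "R B B'" "size B' = size B" "total B' = total B" "balanced (set_mset B')"
    using assms(1,2) by metis
  then have "A' = B'" using assms(3,4) by (intro balanced_unique) auto
  then show ?thesis using A'(1) B'(1) congruent_trans congruent_sym unfolding R_def by blast
qed

text \<open>An exchange cycle has row sums at most \<open>1\<close>, so it fits inside a single matrix of a suitable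
  decomposition. Exchanging along it does not change the column sums of that matrix.\<close>

private lemma congruent_same_cols:
  assumes "set_mset A \<subseteq> T" "set_mset B \<subseteq> T" "size A = size B" "col_sum (total A) = col_sum (total B)"
  shows "monom_poly (cols_monomial A) - monom_poly (cols_monomial B) \<in> I"
  using assms
proof (induction "\<Sum>I\<in>UNIV. \<Sum>i\<in>UNIV. total A I i - total B I i" arbitrary: A rule: less_induct)
  case less
  define M where "M = total A"
  define M' where "M' = total B"
  have M: "M \<in> transports (\<lambda>I. I) (\<lambda>I. size A * (y({} := 0)) I)"
    and M': "M' \<in> transports (\<lambda>I. I) (\<lambda>I. size A * (y({} := 0)) I)"
    using transports_total[OF less.prems(1)[unfolded T_def]] transports_total[OF less.prems(2)[unfolded T_def]]
    unfolding M_def M'_def less.prems(3) by this+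
  show ?case
  proof (cases "M = M'")
    case True
    then show ?thesis using less.prems congruent_same_total by (simp add: M_def M'_def)
  next
    case False
    have rows: "row_sum M = row_sum M'" using M M' by (auto simp: transports_def)
    have cols: "col_sum M = col_sum M'" using less.prems(4) by (simp add: M_def M'_def)
    obtain P Q where PQ: "\<And>I i. P I i \<le> M I i - M' I i" "\<And>I i. Q I i \<le> M' I i - M I i"
      "\<exists>I i. P I i > 0" "row_sum P = row_sum Q" "col_sum P = col_sum Q" "\<And>I. row_sum P I \<le> 1"
      using exchange_cycle[OF rows cols False] by blast
    have PM: "P I i \<le> M I i" for I i by (rule order_trans[OF PQ(1) diff_le_self])
    have "A \<noteq> {#}"
    proof
      assume A: "A = {#}"
      have "size B = 0" unfolding less.prems(3)[symmetric] A by (rule size_empty)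
      then have "B = {#}" by (simp only: size_eq_0_iff_empty)
      then show False using False unfolding M_def M'_def A by blast
    qed
    then obtain k where k: "size A = Suc k" using size_eq_Suc_imp_elem size_eq_0_iff_empty not0_implies_Suc by metis
    \<comment> \<open>A unit of \<open>P\<close> must fit into a row of sum \<open>y I\<close>. If
      that sum is 0, the row of \<open>M\<close> vanishes and so does that of \<open>P\<close>;
      otherwise 1 is small enough.\<close>
    have P_row: "row_sum P I \<le> (y({} := 0)) I" for I
    proof (cases "(y({} := 0)) I = 0")
      case True
      have "row_sum M I = size A * (y({} := 0)) I" using M unfolding transports_def by blast
      then have "row_sum M I = 0" unfolding True by simp
      moreover have "row_sum P I \<le> row_sum M I" by (rule row_sum_mono) (rule PM)
      ultimately show ?thesis by simp
    next
      case False
      then have "1 \<le> (y({} := 0)) I" by simp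
      then show ?thesis by (rule order_trans[OF PQ(6)])
    qed
    obtain a where a: "a \<in> T" "\<And>I i. P I i \<le> a I i" "\<And>I i. a I i \<le> M I i"
      "(\<lambda>I i. M I i - a I i) \<in> transports (\<lambda>I. I) (\<lambda>I. k * (y({} := 0)) I)"
      using transports_split_one[OF M[unfolded k] PM P_row] unfolding T_def by blast
    obtain ms where ms: "size ms = k" "set_mset ms \<subseteq> T" "total ms = (\<lambda>I i. M I i - a I i)"
      using transports_decompose[OF a(4)] unfolding T_def by blast
    define a' where "a' = (\<lambda>I i. (a I i - P I i) + Q I i)"
    have a'_sums: "row_sum a' = row_sum a" "col_sum a' = col_sum a"
      unfolding a'_def using exchange_sums[of P a Q] a(2) PQ(4,5) by auto
    have "i \<in> I" if "a' I i \<noteq> 0" for I i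
    proof -
      have "a I i \<noteq> 0 \<or> M' I i \<noteq> 0" using that PQ(2)[of I i] by (auto simp: a'_def)
      then show ?thesis using a(1) M' unfolding T_def transports_def by blast
    qed
    then have a'_T: "a' \<in> T" using a(1) a'_sums unfolding T_def transports_def by simp
    \<comment> \<open>Passing from \<open>A\<close> to this decomposition, where \<open>a\<close>
      contains all of \<open>P\<close>, keeps the total and so costs only quadratic moves.\<close>
    have total1: "total (add_mset a ms) = M"
      using a(3) ms(3) by (simp add: fun_eq_iff)
    have total2: "total (add_mset a' ms) = (\<lambda>I i. (M I i - P I i) + Q I i)"
    proof (intro ext)
      fix I i
      show "total (add_mset a' ms) I i = (M I i - P I i) + Q I i"
        using a(2)[of I i] a(3)[of I i] ms(3) by (simp add: a'_def)
    qed
    have "cols_monomial (add_mset a ms) = cols_monomial (add_mset a' ms)"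
      using a'_sums(2) int_cols_eq_iff[of a a'] by (simp add: cols_monomial_def)
    moreover have "monom_poly (cols_monomial A) - monom_poly (cols_monomial (add_mset a ms)) \<in> I"
      using less.prems(1) a(1) ms(1,2) k total1 by (intro congruent_same_total) (auto simp: M_def)
    moreover have "monom_poly (cols_monomial (add_mset a' ms)) - monom_poly (cols_monomial B) \<in> I"
    proof (rule less.hyps)
      show "(\<Sum>I\<in>UNIV. \<Sum>i\<in>UNIV. total (add_mset a' ms) I i - total B I i)
          < (\<Sum>I\<in>UNIV. \<Sum>i\<in>UNIV. total A I i - total B I i)"
        unfolding total2 using exchange_distance(2)[OF PQ(1-3)] by (simp add: M_def M'_def)
      show "set_mset (add_mset a' ms) \<subseteq> T" "set_mset B \<subseteq> T" "size (add_mset a' ms) = size B"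
        using a'_T ms k less.prems by auto
      show "col_sum (total (add_mset a' ms)) = col_sum (total B)"
        unfolding total2 using exchange_sums(2)[of P M Q] PM PQ(4,5) less.prems(4) by (simp add: M_def)
    qed
    ultimately show ?thesis using congruent_trans by metis
  qed
qed

lemma toric_quadrics_generate: "fibre_kernel V exponent_vector = I"
  unfolding I_def
proof (rule fibre_kernel_eq_ideal_generated)
  show "exponent_vector (w + u) = exponent_vector (w + v)" if "exponent_vector u = exponent_vector v"
    for u v w :: "int ^ 'n \<Rightarrow>\<^sub>0 nat"
    using that by (simp add: exponent_vector_def)
  show "\<exists>u\<in>monomials V. \<exists>v\<in>monomials V. exponent_vector u = exponent_vector v \<and> g = monom_poly u - monom_poly v"
    if "g \<in> toric_quadrics V" for g :: "(int ^ 'n \<Rightarrow>\<^sub>0 nat) \<Rightarrow>\<^sub>0 'k"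
    using that unfolding toric_quadrics_def by blast
  fix u v assume uv: "u \<in> monomials V" "v \<in> monomials V" "exponent_vector u = exponent_vector v"
  obtain A where A: "set_mset A \<subseteq> T" "u = cols_monomial A"
    using obtain_matrices uv(1) unfolding V_def by blast
  obtain B where B: "set_mset B \<subseteq> T" "v = cols_monomial B"
    using obtain_matrices uv(2) unfolding V_def by blast
  have "monom_poly u - monom_poly v \<in> I"
    unfolding A(2) B(2)
    using A B uv(3) by (intro congruent_same_cols) (auto simp: exponent_vector_cols_monomial int_cols_eq_iff)
  then show "monom_poly u - monom_poly v \<in> (ideal_generated V (toric_quadrics V) :: (_ \<Rightarrow>\<^sub>0 'k) set)"
    by (simp add: I_def)
qed

end

lemma toric_ideal_generated_by_quadratic_binomials:
  fixes y :: "'n::finite set \<Rightarrow> nat"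
  shows "generated_by_quadratic_binomials (lattice_points (Y_polytope y))
    (toric_ideal (Y_polytope y) :: ((int ^ 'n \<Rightarrow>\<^sub>0 nat) \<Rightarrow>\<^sub>0 'k::field) set)"
  unfolding generated_by_quadratic_binomials_def toric_ideal_eq lattice_points_Y_polytope
  using toric_quadrics_generate[where 'k='k and y=y]
  by (intro exI[of _ "toric_quadrics (int_cols ` subset_transports y)"])
    (auto simp: toric_quadrics_def quadratic_binomial_def)

section \<open>A term order with squarefree initial ideal\<close>

text \<open>The choice is unique on lattice points since \<open>mat_less\<close> is total.
  Minimality matters beyond uniqueness: replacing matrices by the chosen ones can never raise a
  total.\<close>

definition min_matrix :: "('n::finite set \<Rightarrow> nat) \<Rightarrow> int ^ 'n \<Rightarrow> 'n set \<Rightarrow> 'n \<Rightarrow> nat" where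
  "min_matrix y \<alpha> = (SOME m. m \<in> subset_transports y \<and> int_cols m = \<alpha> \<and>
     (\<forall>m'\<in>subset_transports y. int_cols m' = \<alpha> \<longrightarrow> \<not> mat_less m' m))"

definition min_matrices :: "('n::finite set \<Rightarrow> nat) \<Rightarrow> (int ^ 'n \<Rightarrow>\<^sub>0 nat) \<Rightarrow> ('n set \<Rightarrow> 'n \<Rightarrow> nat) multiset" where
  "min_matrices y u = image_mset (min_matrix y) (mset_of u)"

text \<open>The weights are compared lexicographically in \<open>t\<close>; the exponents at the end only serve to make
  the weight injective.\<close>

definition term_weight :: "('n::finite set \<Rightarrow> nat) \<Rightarrow> nat \<Rightarrow> (int ^ 'n \<Rightarrow>\<^sub>0 nat) \<Rightarrow> nat \<Rightarrow> nat" where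
  "term_weight y N u t =
    (if t \<le> N then prefix_sum t (total (min_matrices y u))
     else if t = Suc N then \<Sum>m\<in>#min_matrices y u. energy N m
     else Poly_Mapping.lookup u (from_nat (t - Suc (Suc N))))"

definition term_less :: "('n::finite set \<Rightarrow> nat) \<Rightarrow> nat \<Rightarrow> (int ^ 'n \<Rightarrow>\<^sub>0 nat) \<Rightarrow> (int ^ 'n \<Rightarrow>\<^sub>0 nat) \<Rightarrow> bool" where
  "term_less y N u v \<longleftrightarrow> less_fun (term_weight y N u) (term_weight y N v)"

lemma min_matrix:
  assumes "\<alpha> \<in> int_cols ` subset_transports y"
  shows "min_matrix y \<alpha> \<in> subset_transports y" "int_cols (min_matrix y \<alpha>) = \<alpha>"
    and "m \<in> subset_transports y \<Longrightarrow> int_cols m = \<alpha> \<Longrightarrow> min_matrix y \<alpha> = m \<or> mat_less (min_matrix y \<alpha>) m"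
proof -
  let ?S = "{m \<in> subset_transports y. int_cols m = \<alpha>}"
  have "finite ?S" by (rule finite_subset[OF _ finite_transports]) blast
  moreover have "?S \<noteq> {}" using assms by blast
  ultimately obtain m0 where "m0 \<in> ?S" "\<forall>m'\<in>?S. \<not> mat_less m' m0"
    using mat_less_minimum by blast
  then have "\<exists>m. m \<in> subset_transports y \<and> int_cols m = \<alpha> \<and>
     (\<forall>m'\<in>subset_transports y. int_cols m' = \<alpha> \<longrightarrow> \<not> mat_less m' m)" by blast
  from someI_ex[OF this] have *: "min_matrix y \<alpha> \<in> subset_transports y \<and> int_cols (min_matrix y \<alpha>) = \<alpha> \<and>
     (\<forall>m'\<in>subset_transports y. int_cols m' = \<alpha> \<longrightarrow> \<not> mat_less m' (min_matrix y \<alpha>))"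
    unfolding min_matrix_def .
  then show "min_matrix y \<alpha> \<in> subset_transports y" "int_cols (min_matrix y \<alpha>) = \<alpha>" by blast+
  show "min_matrix y \<alpha> = m \<or> mat_less (min_matrix y \<alpha>) m" if "m \<in> subset_transports y" "int_cols m = \<alpha>"
    using * that mat_less_total by blast
qed

lemma min_matrices_add: "min_matrices y (u + v) = min_matrices y u + min_matrices y v"
  by (simp add: min_matrices_def)

lemma min_matrices:
  assumes "u \<in> monomials (int_cols ` subset_transports y)"
  shows "set_mset (min_matrices y u) \<subseteq> subset_transports y" "cols_monomial (min_matrices y u) = u"
proof -
  have keys: "\<And>\<alpha>. \<alpha> \<in># mset_of u \<Longrightarrow> \<alpha> \<in> int_cols ` subset_transports y"
    using assms by (auto simp: monomials_def)
  show "set_mset (min_matrices y u) \<subseteq> subset_transports y"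
    unfolding min_matrices_def using min_matrix(1)[OF keys] by auto
  have "image_mset (\<lambda>\<alpha>. int_cols (min_matrix y \<alpha>)) (mset_of u) = image_mset (\<lambda>\<alpha>. \<alpha>) (mset_of u)"
    by (rule image_mset_cong) (rule min_matrix(2)[OF keys])
  then show "cols_monomial (min_matrices y u) = u"
    by (simp add: cols_monomial_def min_matrices_def image_mset.compositionality comp_def)
qed

text \<open>This handles decompositions whose members are not the chosen matrices, such as those
  produced by sorting: reading them back from their monomial is harmless unless it lowers the
  total.\<close>

lemma min_matrices_cols_monomial:
  fixes y :: "'n::finite set \<Rightarrow> nat"
  assumes "set_mset ms \<subseteq> subset_transports y"
  shows "mat_less (total (min_matrices y (cols_monomial ms))) (total ms) \<or> min_matrices y (cols_monomial ms) = ms"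
proof -
  let ?g = "\<lambda>m. min_matrix y (int_cols m)"
  have eq: "min_matrices y (cols_monomial ms) = image_mset ?g ms"
    by (simp add: min_matrices_def cols_monomial_def image_mset.compositionality comp_def)
  have le: "?g m = m \<or> mat_less (?g m) m" if "m \<in># ms" for m
    using min_matrix(3)[of "int_cols m" y m] assms that by blast
  show ?thesis
  proof (cases "mat_less (total (image_mset ?g ms)) (total ms)")
    case False
    then have *: "total (image_mset ?g ms) = total (image_mset (\<lambda>m. m) ms)"
      using mat_less_total_mset(1)[of ms ?g "\<lambda>m. m", OF le] by simp
    have "image_mset ?g ms = image_mset (\<lambda>m. m) ms"
      by (rule image_mset_cong) (rule mat_less_total_mset(2)[of ms ?g "\<lambda>m. m", OF le *])
    then show ?thesis by (simp add: eq)
  qed (simp add: eq)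
qed

lemma finite_multisets_of_size:
  assumes "finite V"
  shows "finite {A. set_mset A \<subseteq> V \<and> size A = k}"
proof (rule finite_subset)
  show "{A. set_mset A \<subseteq> V \<and> size A = k} \<subseteq> mset ` {xs. set xs \<subseteq> V \<and> length xs = k}"
  proof
    fix A assume A: "A \<in> {A. set_mset A \<subseteq> V \<and> size A = k}"
    obtain xs where "mset xs = A" using ex_mset by blast
    then show "A \<in> mset ` {xs. set xs \<subseteq> V \<and> length xs = k}"
      using A by (intro image_eqI[of _ _ xs]) auto
  qed
  show "finite (mset ` {xs. set xs \<subseteq> V \<and> length xs = k})"
    using finite_lists_length_eq[OF assms] by blast
qed

text \<open>The last coordinate of the exponent vector fixes the degree. Finiteness provides a least
  monomial in each fibre.\<close>

lemma finite_exponent_fibre: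
  assumes "finite V"
  shows "finite {u \<in> monomials V. exponent_vector u = e}"
proof (rule finite_subset)
  show "{u \<in> monomials V. exponent_vector u = e} \<subseteq> monomial_of ` {A. set_mset A \<subseteq> V \<and> size A = nat (snd e)}"
  proof
    fix u assume "u \<in> {u \<in> monomials V. exponent_vector u = e}"
    then show "u \<in> monomial_of ` {A. set_mset A \<subseteq> V \<and> size A = nat (snd e)}"
      by (intro image_eqI[of _ _ "mset_of u"]) (auto simp: monomials_def exponent_vector_eq)
  qed
  show "finite (monomial_of ` {A. set_mset A \<subseteq> V \<and> size A = nat (snd e)})"
    using finite_multisets_of_size[OF assms] by blast
qed

text \<open>Choosing matrices variable by variable makes every component additive, the energy
  included; this makes the order compatible with multiplication.\<close>

lemma term_weight_add: "term_weight y N (u + v) = (\<lambda>t. term_weight y N u t + term_weight y N v t)"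
  by (simp add: term_weight_def min_matrices_add prefix_sum_add lookup_add fun_eq_iff)

lemma term_weight_inj:
  fixes u v :: "int ^ 'n::finite \<Rightarrow>\<^sub>0 nat"
  assumes "term_weight y N u = term_weight y N v"
  shows "u = v"
proof (rule poly_mapping_eqI)
  fix \<alpha> :: "int ^ 'n"
  show "Poly_Mapping.lookup u \<alpha> = Poly_Mapping.lookup v \<alpha>"
    using fun_cong[OF assms, of "to_nat \<alpha> + Suc (Suc N)"] by (simp add: term_weight_def)
qed

lemma term_less_irrefl: "\<not> term_less y N u u"
  by (simp add: term_less_def less_fun_irrefl)

lemma term_less_asym: "term_less y N u v \<Longrightarrow> \<not> term_less y N v u"
  unfolding term_less_def by (rule less_fun_asym)

lemma term_less_trans: "term_less y N u v \<Longrightarrow> term_less y N v w \<Longrightarrow> term_less y N u w"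
  unfolding term_less_def by (rule less_fun_trans)

lemma term_less_linear: "u \<noteq> v \<Longrightarrow> term_less y N u v \<or> term_less y N v u"
  unfolding term_less_def using term_weight_inj by (intro less_fun_nat_trichotomy) blast

lemma term_less_add: "term_less y N u v \<Longrightarrow> term_less y N (u + w) (v + w)"
  by (simp add: term_less_def term_weight_add less_fun_add_iff)

lemma term_less_zero: "\<not> term_less y N u 0"
  by (simp add: term_less_def less_fun_def term_weight_def min_matrices_def)

lemma monomial_order_term_less:
  "monomial_order V {(u, v). u \<in> monomials V \<and> v \<in> monomials V \<and> (u = v \<or> term_less y N u v)}"
  unfolding monomial_order_def
proof (intro conjI ballI impI)
  let ?r = "{(u, v). u \<in> monomials V \<and> v \<in> monomials V \<and> (u = v \<or> term_less y N u v)}"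
  have "trans ?r" by (rule transI) (auto intro: term_less_trans)
  moreover have "antisym ?r" by (rule antisymI) (auto dest: term_less_asym)
  moreover have "refl_on (monomials V) ?r" by (auto simp: refl_on_def)
  moreover have "total_on (monomials V) ?r" using term_less_linear by (fastforce simp: total_on_def)
  ultimately show "linear_order_on (monomials V) ?r"
    by (auto simp: order_on_defs)
  show "(0, u) \<in> ?r" if "u \<in> monomials V" for u
    using that term_less_linear[of 0 u y N] term_less_zero[of y N u] by (auto simp: monomials_def)
  show "(u + w, v + w) \<in> ?r"
    if "u \<in> monomials V" "v \<in> monomials V" "w \<in> monomials V" "(u, v) \<in> ?r" for u v w
    using that by (auto intro: monomials_add term_less_add)
qed

section \<open>Standard monomials and their supports\<close>

context
  fixes y :: "'n::finite set \<Rightarrow> nat" and N :: nat and T :: "('n set \<Rightarrow> 'n \<Rightarrow> nat) set" and V :: "(int ^ 'n) set"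
  assumes N: "\<And>(I::'n set) (i::'n). key I i < N"
  defines "T \<equiv> subset_transports y" and "V \<equiv> int_cols ` T"
begin

text \<open>The least monomial of its fibre, as the order is linear; these are the monomials outside
  the initial ideal.\<close>

private definition standard :: "(int ^ 'n \<Rightarrow>\<^sub>0 nat) \<Rightarrow> bool" where
  "standard u \<longleftrightarrow> u \<in> monomials V \<and>
     (\<forall>v\<in>monomials V. exponent_vector v = exponent_vector u \<longrightarrow> \<not> term_less y N v u)"

private lemma term_less_if_total_less:
  assumes "mat_less (total (min_matrices y u)) (total (min_matrices y v))"
  shows "term_less y N u v"
proof -
  let ?p = "\<lambda>u t. prefix_sum t (total (min_matrices y u))"
  obtain k where k: "?p u k < ?p v k" "\<And>t. t < k \<Longrightarrow> ?p u t = ?p v t"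
    using assms unfolding mat_less_def less_fun_def by blast
  \<comment> \<open>Prefix sums are constant from \<open>N\<close> on, so a first difference occurs
    among the positions recorded in the weight.\<close>
  have "k \<le> N"
  proof (rule ccontr)
    assume "\<not> k \<le> N"
    then have "?p u N = ?p v N" using k(2) by simp
    moreover have "?p w k = ?p w N" for w
      using \<open>\<not> k \<le> N\<close> by (intro prefix_sum_const N) simp
    ultimately show False using k(1) by simp
  qed
  then show ?thesis
    unfolding term_less_def less_fun_def using k
    by (intro exI[of _ k]) (simp add: term_weight_def)
qed

private lemma term_less_if_energy_less:
  assumes "total (min_matrices y u) = total (min_matrices y v)"
    "(\<Sum>m\<in>#min_matrices y u. energy N m) < (\<Sum>m\<in>#min_matrices y v. energy N m)"
  shows "term_less y N u v"
  unfolding term_less_def less_fun_def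
  by (intro exI[of _ "Suc N"]) (use assms in \<open>simp add: term_weight_def\<close>)

private lemma standard_not_less:
  assumes "standard u" "set_mset ms \<subseteq> T" "size ms = size (min_matrices y u)"
    "int_cols (total ms) = int_cols (total (min_matrices y u))"
  shows "\<not> term_less y N (cols_monomial ms) u"
proof -
  have "u = cols_monomial (min_matrices y u)"
    using assms(1) min_matrices(2) unfolding standard_def V_def T_def by metis
  then have "exponent_vector (cols_monomial ms) = exponent_vector u"
    using exponent_vector_cols_monomial[of ms] exponent_vector_cols_monomial[of "min_matrices y u"] assms(3,4)
    by simp
  then show ?thesis
    using assms(1,2) cols_monomial_in_monomials unfolding standard_def V_def by blast
qed

private lemma standard_transports:
  assumes "u \<in> monomials V"
  shows "set_mset (min_matrices y u) \<subseteq> T"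
    "total (min_matrices y u) \<in> transports (\<lambda>I. I) (\<lambda>I. size (min_matrices y u) * (y({} := 0)) I)"
proof -
  show *: "set_mset (min_matrices y u) \<subseteq> T"
    using assms min_matrices(1) unfolding V_def T_def by blast
  then show "total (min_matrices y u) \<in> transports (\<lambda>I. I) (\<lambda>I. size (min_matrices y u) * (y({} := 0)) I)"
    unfolding T_def by (rule transports_total)
qed

text \<open>A smaller matrix with the same row and column sums would decompose into a monomial of
  the same fibre. Reading it through the chosen matrices can only lower the total further, so that
  monomial would be smaller.\<close>

private lemma standard_lex_minimal:
  assumes "standard u"
  shows "lex_minimal (\<lambda>I. I) (total (min_matrices y u))"
  unfolding lex_minimal_def
proof (intro ballI impI notI)
  let ?M = "total (min_matrices y u)"
  fix M' assume M': "M' \<in> transports (\<lambda>I. I) (row_sum ?M)" "col_sum M' = col_sum ?M" "mat_less M' ?M"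
  have "?M \<in> transports (\<lambda>I. I) (\<lambda>I. size (min_matrices y u) * (y({} := 0)) I)"
    using standard_transports(2) assms unfolding standard_def by blast
  then have "row_sum ?M = (\<lambda>I. size (min_matrices y u) * (y({} := 0)) I)"
    unfolding transports_def by blast
  then obtain ms where ms: "size ms = size (min_matrices y u)" "set_mset ms \<subseteq> T" "total ms = M'"
    using transports_decompose[of M' "\<lambda>I. I"] M'(1) unfolding T_def by metis
  have "\<not> term_less y N (cols_monomial ms) u"
    using standard_not_less[OF assms ms(2,1)] M'(2) ms(3) by (simp add: int_cols_eq_iff)
  moreover have "mat_less (total (min_matrices y (cols_monomial ms))) ?M"
    using min_matrices_cols_monomial[of ms y] ms M'(3) mat_less_trans unfolding T_def by metis
  ultimately show False using term_less_if_total_less by blast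
qed

text \<open>Sort an offending pair. If the result does not consist of chosen matrices, its monomial
  has a smaller total; if it does, the total is unchanged and the energy drops. Either way a smaller
  monomial appears in the fibre.\<close>

private lemma standard_balanced:
  assumes "standard u"
  shows "balanced (set_mset (min_matrices y u))"
proof (rule ccontr)
  let ?A = "min_matrices y u"
  assume "\<not> balanced (set_mset ?A)"
  then obtain a b where ab: "a \<in># ?A" "b \<in># ?A" "\<not> interleaved a b" "\<not> interleaved b a"
    unfolding balanced_def by blast
  have "a \<noteq> b" using ab(3) by (auto simp: interleaved_def)
  obtain A1 where A1: "?A = add_mset a A1" using ab(1) by (meson mset_add)
  then have "b \<in># A1" using ab(2) \<open>a \<noteq> b\<close> by simp
  then obtain A' where "A1 = add_mset b A'" by (meson mset_add)
  then have A': "?A = A' + {#a, b#}" using A1 by simp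
  have T: "set_mset ?A \<subseteq> T" using assms standard_transports(1) unfolding standard_def by blast
  then have "a \<in> T" "b \<in> T" using ab by blast+
  then obtain c d where cd: "c \<in> T" "d \<in> T" "\<And>I i. c I i + d I i = a I i + b I i" "interleaved d c"
    unfolding T_def using sort_pair by blast
  define B where "B = A' + {#c, d#}"
  have "total {#c, d#} = total {#a, b#}" using cd(3) by (simp add: fun_eq_iff)
  then have total: "total B = total ?A" unfolding A' B_def total_simps(3) by (simp only:)
  have B: "set_mset B \<subseteq> T" "size B = size ?A"
    using T cd(1,2) by (simp_all add: A' B_def)
  have not_less: "\<not> term_less y N (cols_monomial B) u"
    by (rule standard_not_less[OF assms B]) (simp only: total)
  then have "\<not> mat_less (total (min_matrices y (cols_monomial B))) (total B)"
    unfolding total using term_less_if_total_less by blast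
  then have *: "min_matrices y (cols_monomial B) = B"
    using min_matrices_cols_monomial[OF B(1)[unfolded T_def]] by blast
  have "energy N c + energy N d < energy N a + energy N b"
    by (rule energy_sort_less[OF N cd(3,4) ab(3,4)])
  then have "(\<Sum>m\<in>#B. energy N m) < (\<Sum>m\<in>#?A. energy N m)" by (simp add: A' B_def)
  then have "term_less y N (cols_monomial B) u"
    by (intro term_less_if_energy_less) (simp_all only: * total)
  then show False using not_less by blast
qed

private lemma standard_below:
  assumes "u \<in> monomials V"
  obtains v where "standard v" "exponent_vector v = exponent_vector u" "v = u \<or> term_less y N v u"
proof -
  let ?S = "{v \<in> monomials V. exponent_vector v = exponent_vector u}"
  have "finite V" unfolding V_def T_def using finite_transports by blast
  then have "finite ?S" by (rule finite_exponent_fibre)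
  moreover have "asymp_on ?S (term_less y N)" "transp_on ?S (term_less y N)"
    unfolding asymp_on_def transp_on_def by (blast dest: term_less_asym term_less_trans)+
  moreover have "?S \<noteq> {}" using assms by blast
  ultimately obtain v where v: "v \<in> ?S" "\<forall>x\<in>?S. x \<noteq> v \<longrightarrow> \<not> term_less y N x v"
    using Finite_Set.bex_min_element[of ?S "term_less y N"] by blast
  have "standard v" unfolding standard_def using v term_less_irrefl by auto
  moreover have "v = u \<or> term_less y N v u" using v(2) assms term_less_linear[of u v y N] by auto
  ultimately show ?thesis using v(1) that by blast
qed

text \<open>Compare \<open>v\<close> with the standard monomial \<open>x\<close> of its fibre. The
  total of \<open>v\<close> is lexicographically least by \<open>lex_minimal_support\<close>, so the
  totals agree; both multisets are balanced, that of \<open>v\<close> as part of that of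
  \<open>u\<close>, and hence coincide.\<close>

lemma standard_support:
  assumes u: "standard u" and v: "v \<in> monomials V" "Poly_Mapping.keys v \<subseteq> Poly_Mapping.keys u"
  shows "standard v"
proof -
  obtain x where x: "standard x" "exponent_vector x = exponent_vector v" "x = v \<or> term_less y N x v"
    using standard_below[OF v(1)] by blast
  have "x = v"
  proof (rule ccontr)
    assume "x \<noteq> v"
    then have less: "term_less y N x v" using x(3) by blast
    let ?M = "\<lambda>u. total (min_matrices y u)"
    have sub: "set_mset (min_matrices y v) \<subseteq> set_mset (min_matrices y u)"
      using v(2) by (auto simp: min_matrices_def)
    have xV: "x \<in> monomials V" and uV: "u \<in> monomials V" using x(1) u by (simp_all add: standard_def)
    have "v = cols_monomial (min_matrices y v)" "x = cols_monomial (min_matrices y x)"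
      using min_matrices(2) v(1) xV unfolding V_def T_def by metis+
    then have ev: "int_cols (?M x) = int_cols (?M v)" "size (min_matrices y x) = size (min_matrices y v)"
      using x(2) exponent_vector_cols_monomial[of "min_matrices y v"]
        exponent_vector_cols_monomial[of "min_matrices y x"] by simp_all
    have Mv: "?M v \<in> transports (\<lambda>I. I) (\<lambda>I. size (min_matrices y v) * (y({} := 0)) I)"
      and Mx: "?M x \<in> transports (\<lambda>I. I) (\<lambda>I. size (min_matrices y v) * (y({} := 0)) I)"
      using standard_transports(2)[OF v(1)] standard_transports(2)[OF xV] ev(2) by simp_all
    have Mu: "?M u \<in> transports (\<lambda>I. I) (row_sum (?M u))"
      using standard_transports(2)[OF uV] by (auto simp: transports_def)
    have "lex_minimal (\<lambda>I. I) (?M v)"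
    proof (rule lex_minimal_support[OF standard_lex_minimal[OF u] Mu])
      fix I i assume "?M v I i \<noteq> 0"
      then obtain m where "m \<in># min_matrices y v" "m I i \<noteq> 0"
        by (auto simp: total_def)
      then show "?M u I i \<noteq> 0" using sub by (auto simp: total_def)
    qed
    moreover have "row_sum (?M v) = (\<lambda>I. size (min_matrices y v) * (y({} := 0)) I)"
      using Mv unfolding transports_def by blast
    ultimately have "\<not> mat_less (?M x) (?M v)"
      using Mx ev(1) unfolding lex_minimal_def int_cols_eq_iff by simp
    \<comment> \<open>Totals are compared first, so a smaller total for \<open>v\<close> would put
      \<open>v\<close> below \<open>x\<close>.\<close>
    moreover have "\<not> mat_less (?M v) (?M x)"
      using less term_less_if_total_less term_less_asym by blast
    ultimately have "?M x = ?M v" using mat_less_total by blast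
    moreover have "balanced (set_mset (min_matrices y v))"
      using standard_balanced[OF u] sub unfolding balanced_def by blast
    ultimately have "min_matrices y x = min_matrices y v"
      using ev(2) standard_balanced[OF x(1)] by (intro balanced_unique)
    then show False
      using \<open>v = cols_monomial (min_matrices y v)\<close> \<open>x = cols_monomial (min_matrices y x)\<close> \<open>x \<noteq> v\<close> by simp
  qed
  then show ?thesis using x(1) by simp
qed

lemma squarefree_initial_ideal_int_cols:
  "has_squarefree_initial_ideal V (fibre_kernel V exponent_vector :: (_ \<Rightarrow>\<^sub>0 'k::field) set)"
proof (rule squarefree_initial_ideal_fibre_kernel[OF monomial_order_term_less[of V y N]])
  fix u v
  assume uv: "u \<in> monomials V" "v \<in> monomials V" "exponent_vector u = exponent_vector v" "u \<noteq> v"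
    "(v, u) \<in> {(u, v). u \<in> monomials V \<and> v \<in> monomials V \<and> (u = v \<or> term_less y N u v)}"
  then have "\<not> standard u" by (auto simp: standard_def)
  \<comment> \<open>\<open>S\<close> takes each variable of \<open>u\<close> once, so
    \<open>w\<close> is the radical of \<open>u\<close>. Both have the same support, hence
    \<open>w\<close> cannot be standard when \<open>u\<close> is not.\<close>
  define S where "S = mset_set (Poly_Mapping.keys u)"
  define w where "w = monomial_of S"
  define w' where "w' = monomial_of (mset_of u - S)"
  have "S \<subseteq># mset_of u"
    by (rule mset_subset_eqI) (auto simp: S_def count_mset_set' in_keys_iff)
  then have "monomial_of (mset_of u - S + S) = u" by (simp add: subset_mset.diff_add)
  then have u: "u = w' + w" by (simp add: w_def w'_def monomial_of_add)
  have keys: "Poly_Mapping.keys w = Poly_Mapping.keys u"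
    by (metis S_def finite_keys finite_set_mset_mset_set mset_of_monomial_of set_mset_of w_def)
  then have w: "w \<in> monomials V" using uv(1) by (simp add: monomials_def)
  have w': "w' \<in> monomials V"
    using uv(1) unfolding w'_def monomial_of_in_monomials by (auto simp: monomials_def dest!: in_diffD)
  have "\<not> standard w" using \<open>\<not> standard u\<close> standard_support[of w u] uv(1) keys by blast
  then obtain x where x: "x \<in> monomials V" "exponent_vector x = exponent_vector w" "term_less y N x w"
    using w unfolding standard_def by blast
  have "x \<noteq> w" using x(3) term_less_irrefl by blast
  moreover have "squarefree_monomial w"
    by (simp add: squarefree_monomial_def w_def S_def count_mset_set')
  ultimately show "\<exists>w\<in>monomials V. \<exists>w'\<in>monomials V. squarefree_monomial w \<and> u = w' + w \<and>
      (\<exists>x\<in>monomials V. exponent_vector x = exponent_vector w \<and> x \<noteq> w \<and>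
        (x, w) \<in> {(u, v). u \<in> monomials V \<and> v \<in> monomials V \<and> (u = v \<or> term_less y N u v)})"
    using u w w' x by (intro bexI[of _ w] bexI[of _ w']) auto
qed

end

lemma toric_ideal_squarefree_initial_ideal:
  fixes y :: "'n::finite set \<Rightarrow> nat"
  shows "has_squarefree_initial_ideal (lattice_points (Y_polytope y))
    (toric_ideal (Y_polytope y) :: ((int ^ 'n \<Rightarrow>\<^sub>0 nat) \<Rightarrow>\<^sub>0 'k::field) set)"
proof -
  obtain N where "\<And>(I::'n set) (i::'n). key I i < N" using key_bounded by blast
  then show ?thesis
    unfolding toric_ideal_eq lattice_points_Y_polytope by (rule squarefree_initial_ideal_int_cols)
qed

theorem theorem1p3:
  fixes y :: "'n::finite set \<Rightarrow> nat" and P :: "(real ^ 'n) set"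
  assumes "P = Y_polytope y"
  shows "IDP P \<and>
         has_squarefree_initial_ideal (lattice_points P)
           (toric_ideal P :: ((int ^ 'n \<Rightarrow>\<^sub>0 nat) \<Rightarrow>\<^sub>0 'k::field) set) \<and>
         generated_by_quadratic_binomials (lattice_points P)
           (toric_ideal P :: ((int ^ 'n \<Rightarrow>\<^sub>0 nat) \<Rightarrow>\<^sub>0 'k::field) set)"
  unfolding assms
  using IDP_Y_polytope toric_ideal_squarefree_initial_ideal
    toric_ideal_generated_by_quadratic_binomials by blast

end
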